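(* Let $F$ be a field of characteristic zero. For every $n\ge1$ and all compositions $\lambda,\eta$, one has in $\mathrm{NSym}$ (over $F$) $$\mathbf s_{(n)}\,\mathbf s_{\lambda/\eta}=\sum_{a+b=n,\ a,b\ge0}(-1)^b\sum_{\substack{\rho,\mu:\ \lambda\xrightarrow{\mathrm{LH}}_a\rho \\ \mu\xrightarrow{\mathrm{LV}}_b\eta}}\mathbf s_{\rho/\mu},\qquad \mathbf s_{(1^n)}\,\mathbf s_{\lambda/\eta}=\sum_{a+b=n,\ a,b\ge0}(-1)^b\sum_{\substack{\rho,\mu:\ \lambda\xrightarrow{\mathrm{LV}}_a\rho \\ \mu\xrightarrow{\mathrm{LH}}_b\eta}}\mathbf s_{\rho/\mu}.$$
   Context: $\mathrm{NSym}=F\langle H_1,H_2,\dots\rangle$ with $\Delta(H_r)=\sum_{i+j=r}H_i\otimes H_j$ ($H_0=1$), graded Hopf dual to $\mathrm{QSym}$ via $\langle H_\alpha,M_\beta\rangle=\delta_{\alpha\beta}$ ($H_\alpha=H_{\alpha_1}H_{\alpha_2}\cdots$, $M_\beta$ monomial quasisymmetric functions). The noncommutative Schur functions $\mathbf s_\alpha$ are the basis of $\mathrm{NSym}$ dual to the quasisymmetric Schur functions $\mathcal S_\alpha$, where $\mathcal S_\alpha=\sum_Tx^T$ over fillings $T$ of the diagram of $\alpha$ (row $i$ from the top has $\alpha_i$ left-justified boxes) by positive integers with rows weakly decreasing left to right, first column strictly increasing top to bottom, and, extending $T$ by zeros to a rectangle, for $i<j$, $c\ge2$: $T(j,c)\ne0$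 and $T(j,c)\ge T(i,c)$ imply $T(j,c)>T(i,c-1)$. Skew elements: $\Delta(\mathbf s_\lambda)=\sum_\eta\mathbf s_{\lambda/\eta}\otimes\mathbf s_\eta$. **Left strips.** For a composition $\alpha$: $t_1(\alpha)=(1,\alpha_1,\dots,\alpha_\ell)$; for $i\ge2$, $t_i(\alpha)$ is obtained by adding $1$ to the leftmost part of $\alpha$ equal to $i-1$, and $t_i(\alpha)=0$ if there is no such part; $0$ is a formal absorbing symbol, $t_j(0)=0$. For $m>0$, $\alpha\xrightarrow{\mathrm{LH}}_m\beta$ means $\beta=t_{i_m}\cdots t_{i_1}(\alpha)$ for some $1\le i_1<\cdots<i_m$, and $\alpha\xrightarrow{\mathrm{LV}}_m\beta$ means $\beta=t_{i_m}\cdots t_{i_1}(\alpha)$ for some $i_1\ge\cdots\ge i_m\ge1$ (here $\alpha,\beta$ are genuine compositions). For $m=0$ both relations mean $\alpha=\beta$. *)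

theory Defs
  imports Complex_Main "HOL-Library.Poly_Mapping" "HOL-Library.Product_Plus"
begin

section \<open>Compositions\<close>

typedef composition = "{xs :: nat list. \<forall>x\<in>set xs. 0 < x}"
  morphisms parts Composition
  by (rule exI[of _ "[]"]) simp

setup_lifting type_definition_composition

text \<open>Compositions form the free monoid on the positive integers, written additively
  so that \<^typ>\<open>composition \<Rightarrow>\<^sub>0 'a\<close> is its monoid algebra.\<close>

instantiation composition :: monoid_add
begin

lift_definition zero_composition :: composition is "[]" by simp

lift_definition plus_composition :: "composition \<Rightarrow> composition \<Rightarrow> composition" is "(@)"
  by auto

instance by standard (transfer; simp)+

end

text \<open>The one-row composition \<open>(n)\<close>, which is the empty composition for \<open>n = 0\<close>.\<close>

lift_definition row_comp :: "nat \<Rightarrow> composition" is "\<lambda>n. if n = 0 then [] else [n]"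
  by (auto split: if_splits)

lift_definition column_comp :: "nat \<Rightarrow> composition" is "\<lambda>n. replicate n 1"
  by simp

section \<open>Noncommutative symmetric functions\<close>

type_synonym 'a nsym = "composition \<Rightarrow>\<^sub>0 'a"

text \<open>\<open>NSym \<otimes> NSym\<close> is the monoid algebra of the product monoid; the pair \<open>(\<alpha>, \<beta>)\<close>
  stands for \<open>H\<^sub>\<alpha> \<otimes> H\<^sub>\<beta>\<close>.\<close>

type_synonym 'a nsym2 = "(composition \<times> composition) \<Rightarrow>\<^sub>0 'a"

definition H :: "composition \<Rightarrow> 'a::semiring_1 nsym" where
  "H \<alpha> = Poly_Mapping.single \<alpha> 1"

definition tensor :: "'a::semiring_1 nsym \<Rightarrow> 'a nsym \<Rightarrow> 'a nsym2" where
  "tensor g h = (\<Sum>\<alpha>\<in>Poly_Mapping.keys g. \<Sum>\<beta>\<in>Poly_Mapping.keys h.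
     Poly_Mapping.single (\<alpha>, \<beta>) (Poly_Mapping.lookup g \<alpha> * Poly_Mapping.lookup h \<beta>))"

definition coproduct_gen :: "nat \<Rightarrow> 'a::semiring_1 nsym2" where
  "coproduct_gen r = (\<Sum>i\<le>r. tensor (H (row_comp i)) (H (row_comp (r - i))))"

text \<open>The algebra homomorphism extending \<^const>\<open>coproduct_gen\<close>; the factor
  \<^term>\<open>Poly_Mapping.single 0 c\<close> is the scalar \<open>c\<close>.\<close>

definition coproduct :: "'a::semiring_1 nsym \<Rightarrow> 'a nsym2" where
  "coproduct h = (\<Sum>\<alpha>\<in>Poly_Mapping.keys h.
     Poly_Mapping.single 0 (Poly_Mapping.lookup h \<alpha>) * prod_list (map coproduct_gen (parts \<alpha>)))"

lemma H_0 [simp]: "H 0 = 1"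
  by (simp add: H_def)

lemma H_plus: "H (\<alpha> + \<beta>) = H \<alpha> * H \<beta>"
  by (simp add: H_def mult_single)

lemma coproduct_superset:
  assumes "finite A" "Poly_Mapping.keys h \<subseteq> A"
  shows "coproduct h = (\<Sum>\<alpha>\<in>A. Poly_Mapping.single 0 (Poly_Mapping.lookup h \<alpha>) *
           prod_list (map coproduct_gen (parts \<alpha>)))"
  unfolding coproduct_def
  by (rule sum.mono_neutral_left) (use assms in \<open>auto simp: in_keys_iff\<close>)

lemma coproduct_add: "coproduct (g + h) = coproduct g + coproduct h"
proof -
  let ?A = "Poly_Mapping.keys g \<union> Poly_Mapping.keys h"
  have "Poly_Mapping.keys (g + h) \<subseteq> ?A" by (rule Poly_Mapping.keys_add)
  then show ?thesis
    by (simp add: coproduct_superset[of ?A] lookup_add single_add distrib_right sum.distrib)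
qed

lemma coproduct_H: "coproduct (H \<alpha>) = prod_list (map coproduct_gen (parts \<alpha>))"
  by (simp add: coproduct_def H_def)

lemma coproduct_H_mult: "coproduct (H \<alpha> * H \<beta>) = coproduct (H \<alpha>) * coproduct (H \<beta>)"
  by (simp add: H_plus[symmetric] coproduct_H plus_composition.rep_eq)

section \<open>Quasisymmetric functions\<close>

text \<open>Formal power series in \<open>x\<^sub>1, x\<^sub>2, \<dots>\<close> are coefficient functions on monomials; a monomial
  is its exponent vector, and the variable with index 0 is never used.\<close>

type_synonym monomial = "nat \<Rightarrow>\<^sub>0 nat"
type_synonym 'a series = "monomial \<Rightarrow> 'a"

text \<open>The sum of the monomials \<open>w t\<close> over \<open>t \<in> I\<close>, for \<open>w\<close> with finite fibres on \<open>I\<close>.\<close>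

definition sum_of_monomials :: "'t set \<Rightarrow> ('t \<Rightarrow> monomial) \<Rightarrow> 'a::semiring_1 series" where
  "sum_of_monomials I w = (\<lambda>m. of_nat (card {t \<in> I. w t = m}))"

text \<open>The monomial \<open>x\<^sub>i\<^sub>1\<^bsup>\<beta>\<^sub>1\<^esup> \<cdots> x\<^sub>i\<^sub>k\<^bsup>\<beta>\<^sub>k\<^esup>\<close>.\<close>

definition power_monomial :: "composition \<Rightarrow> nat list \<Rightarrow> monomial" where
  "power_monomial \<beta> is =
     (\<Sum>j<length (parts \<beta>). Poly_Mapping.single (is ! j) (parts \<beta> ! j))"

definition monomial_qsym :: "composition \<Rightarrow> 'a::semiring_1 series" where
  "monomial_qsym \<beta> = sum_of_monomials
     {is. length is = length (parts \<beta>) \<and> sorted_wrt (<) is \<and> (\<forall>i\<in>set is. 1 \<le> i)}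
     (power_monomial \<beta>)"

text \<open>The monomial \<open>x\<^sub>1\<^bsup>\<alpha>\<^sub>1\<^esup> \<cdots> x\<^sub>k\<^bsup>\<alpha>\<^sub>k\<^esup>\<close>.\<close>

definition initial_monomial :: "composition \<Rightarrow> monomial" where
  "initial_monomial \<alpha> = power_monomial \<alpha> [1..<Suc (length (parts \<alpha>))]"

text \<open>The bilinear pairing with \<open>\<langle>H\<^sub>\<alpha>, M\<^sub>\<beta>\<rangle> = \<delta>\<^sub>\<alpha>\<^sub>\<beta>\<close>. The coefficient of \<open>M\<^sub>\<alpha>\<close> in a
  quasisymmetric function is its coefficient at \<open>x\<^sub>1\<^bsup>\<alpha>\<^sub>1\<^esup> \<cdots> x\<^sub>k\<^bsup>\<alpha>\<^sub>k\<^esup>\<close>; see \<open>pairing_H_M\<close> and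
  \<open>pairing_H_sum_M\<close> below.\<close>

definition pairing :: "'a::semiring_1 nsym \<Rightarrow> 'a series \<Rightarrow> 'a" where
  "pairing h f = (\<Sum>\<alpha>\<in>Poly_Mapping.keys h. Poly_Mapping.lookup h \<alpha> * f (initial_monomial \<alpha>))"

lemma parts_pos: "j < length (parts \<beta>) \<Longrightarrow> 0 < parts \<beta> ! j"
  using parts[of \<beta>] by auto

lemma lookup_power_monomial:
  assumes "length is = length (parts \<beta>)" "distinct is" "j < length (parts \<beta>)"
  shows "Poly_Mapping.lookup (power_monomial \<beta> is) (is ! j) = parts \<beta> ! j"
proof -
  have "Poly_Mapping.lookup (power_monomial \<beta> is) (is ! j) =
      (\<Sum>i<length (parts \<beta>). if i = j then parts \<beta> ! i else 0)"
    unfolding power_monomial_def lookup_sum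
    by (rule sum.cong) (use assms in \<open>auto simp: lookup_single when_def nth_eq_iff_index_eq\<close>)
  then show ?thesis using assms by simp
qed

lemma keys_power_monomial:
  assumes "length is = length (parts \<beta>)" "distinct is"
  shows "Poly_Mapping.keys (power_monomial \<beta> is) = set is"
proof
  show "Poly_Mapping.keys (power_monomial \<beta> is) \<subseteq> set is"
  proof
    fix x assume "x \<in> Poly_Mapping.keys (power_monomial \<beta> is)"
    then have "(\<Sum>i<length (parts \<beta>). Poly_Mapping.lookup (Poly_Mapping.single (is ! i) (parts \<beta> ! i)) x) \<noteq> 0"
      by (simp add: in_keys_iff power_monomial_def lookup_sum)
    then obtain i where "i \<in> {..<length (parts \<beta>)}"
      "Poly_Mapping.lookup (Poly_Mapping.single (is ! i) (parts \<beta> ! i)) x \<noteq> 0"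
      by (rule sum.not_neutral_contains_not_neutral)
    then show "x \<in> set is" using assms by (auto simp: lookup_single when_def split: if_splits)
  qed
  show "set is \<subseteq> Poly_Mapping.keys (power_monomial \<beta> is)"
  proof
    fix x assume "x \<in> set is"
    then obtain j where "j < length (parts \<beta>)" "x = is ! j"
      using assms(1) by (metis in_set_conv_nth)
    then show "x \<in> Poly_Mapping.keys (power_monomial \<beta> is)"
      using lookup_power_monomial[OF assms] parts_pos[of j \<beta>] by (simp add: in_keys_iff)
  qed
qed

lemma power_monomial_inj:
  assumes "length is = length (parts \<beta>)" "sorted_wrt (<) is"
    and "length js = length (parts \<alpha>)" "sorted_wrt (<) js"
    and eq: "power_monomial \<beta> is = power_monomial \<alpha> js"
  shows "is = js \<and> \<beta> = \<alpha>"
proof -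
  have d: "distinct is" "distinct js"
    using assms(2,4) strict_sorted_iff by blast+
  have "set is = set js"
    using keys_power_monomial[OF assms(1) d(1)] keys_power_monomial[OF assms(3) d(2)] eq by simp
  then have ij: "is = js"
    using assms(2,4) strict_sorted_equal by blast
  have len: "length (parts \<beta>) = length (parts \<alpha>)"
    using assms(1,3) ij by simp
  have "parts \<beta> ! j = parts \<alpha> ! j" if "j < length (parts \<beta>)" for j
  proof -
    have "parts \<beta> ! j = Poly_Mapping.lookup (power_monomial \<beta> is) (is ! j)"
      by (rule lookup_power_monomial[symmetric]) (fact assms d that)+
    also have "\<dots> = Poly_Mapping.lookup (power_monomial \<alpha> js) (js ! j)"
      by (simp only: eq flip: ij)
    also have "\<dots> = parts \<alpha> ! j"
      by (rule lookup_power_monomial) (use assms(3) d(2) that len in simp_all)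
    finally show ?thesis .
  qed
  with len have "parts \<beta> = parts \<alpha>" by (rule nth_equalityI)
  with ij show ?thesis by (simp add: parts_inject)
qed

lemma monomial_qsym_coeff:
  "monomial_qsym \<beta> (initial_monomial \<alpha>) = (if \<alpha> = \<beta> then 1 else 0)"
proof -
  define js where "js = [1..<Suc (length (parts \<alpha>))]"
  let ?I = "{is. length is = length (parts \<beta>) \<and> sorted_wrt (<) is \<and> (\<forall>i\<in>set is. 1 \<le> i)}"
  have js: "length js = length (parts \<alpha>)" "sorted_wrt (<) js" "\<forall>i\<in>set js. 1 \<le> i"
    by (simp_all add: js_def del: upt_Suc)
  have "is \<in> ?I \<and> power_monomial \<beta> is = power_monomial \<alpha> js \<longleftrightarrow> is = js \<and> \<alpha> = \<beta>" for "is"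
  proof
    assume "is \<in> ?I \<and> power_monomial \<beta> is = power_monomial \<alpha> js"
    then have "is = js \<and> \<beta> = \<alpha>" by (intro power_monomial_inj) (simp_all add: js)
    then show "is = js \<and> \<alpha> = \<beta>" by blast
  next
    assume "is = js \<and> \<alpha> = \<beta>"
    with js show "is \<in> ?I \<and> power_monomial \<beta> is = power_monomial \<alpha> js" by simp
  qed
  then have "{is \<in> ?I. power_monomial \<beta> is = power_monomial \<alpha> js} = (if \<alpha> = \<beta> then {js} else {})"
    by auto
  then show ?thesis
    unfolding monomial_qsym_def sum_of_monomials_def initial_monomial_def js_def[symmetric] by simp
qed

lemma pairing_H: "pairing (H \<alpha>) f = f (initial_monomial \<alpha>)"
  by (simp add: pairing_def H_def)

lemma pairing_H_M: "pairing (H \<alpha>) (monomial_qsym \<beta>) = (if \<alpha> = \<beta> then 1 else 0)"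
  by (simp add: pairing_H monomial_qsym_coeff)

lemma pairing_H_sum_M:
  assumes "finite A"
  shows "pairing (H \<alpha>) (\<lambda>m. \<Sum>\<beta>\<in>A. c \<beta> * monomial_qsym \<beta> m) = (if \<alpha> \<in> A then c \<alpha> else 0)"
proof -
  have "(\<Sum>\<beta>\<in>A. c \<beta> * (if \<alpha> = \<beta> then 1 else 0)) = (\<Sum>\<beta>\<in>A. if \<alpha> = \<beta> then c \<beta> else 0)"
    by (rule sum.cong) auto
  then show ?thesis using assms by (simp add: pairing_H monomial_qsym_coeff)
qed

section \<open>Quasisymmetric Schur functions\<close>

text \<open>Rows and columns of diagrams and fillings are indexed from 0.\<close>

definition diagram :: "composition \<Rightarrow> (nat \<times> nat) set" where
  "diagram \<alpha> = {(i, c). i < length (parts \<alpha>) \<and> c < parts \<alpha> ! i}"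

text \<open>A filling is already extended by zeros outside the diagram.\<close>

definition fillings :: "composition \<Rightarrow> (nat \<Rightarrow> nat \<Rightarrow> nat) set" where
  "fillings \<alpha> = {T.
     (\<forall>i c. 0 < T i c \<longleftrightarrow> (i, c) \<in> diagram \<alpha>) \<and>
     (\<forall>i c. (i, Suc c) \<in> diagram \<alpha> \<longrightarrow> T i (Suc c) \<le> T i c) \<and>
     (\<forall>i j. i < j \<and> j < length (parts \<alpha>) \<longrightarrow> T i 0 < T j 0) \<and>
     (\<forall>i j c. i < j \<and> j < length (parts \<alpha>) \<longrightarrow>
        T j (Suc c) \<noteq> 0 \<and> T i (Suc c) \<le> T j (Suc c) \<longrightarrow> T i c < T j (Suc c))}"

definition filling_monomial :: "composition \<Rightarrow> (nat \<Rightarrow> nat \<Rightarrow> nat) \<Rightarrow> monomial" where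
  "filling_monomial \<alpha> T = (\<Sum>(i, c)\<in>diagram \<alpha>. Poly_Mapping.single (T i c) 1)"

definition qsym_schur :: "composition \<Rightarrow> 'a::semiring_1 series" where
  "qsym_schur \<alpha> = sum_of_monomials (fillings \<alpha>) (filling_monomial \<alpha>)"

section \<open>Noncommutative Schur functions and their skew versions\<close>

definition nc_schur :: "composition \<Rightarrow> 'a::field_char_0 nsym" where
  "nc_schur \<alpha> = (THE s. \<forall>\<beta>. pairing s (qsym_schur \<beta>) = (if \<alpha> = \<beta> then 1 else 0))"

text \<open>\<open>skew_nc_schur \<Lambda> \<eta>\<close> is \<open>s\<^bsub>\<Lambda>/\<eta>\<^esub>\<close>; it is well defined because the \<open>s\<^sub>\<eta>\<close> form a basis.\<close>

definition skew_nc_schur :: "composition \<Rightarrow> composition \<Rightarrow> 'a::field_char_0 nsym" where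
  "skew_nc_schur \<Lambda> = (THE g. finite {\<eta>. g \<eta> \<noteq> 0} \<and>
     coproduct (nc_schur \<Lambda>) = (\<Sum>\<eta> | g \<eta> \<noteq> 0. tensor (g \<eta>) (nc_schur \<eta>)))"

section \<open>Left strips\<close>

text \<open>The formal symbol \<open>0\<close> is \<^const>\<open>None\<close>. Only indices \<open>i \<ge> 1\<close> occur.\<close>

lift_definition left_add :: "nat \<Rightarrow> composition \<Rightarrow> composition option" is
  "\<lambda>i xs. if i = 1 then Some (1 # xs)
     else if 2 \<le> i \<and> i - 1 \<in> set xs
       then Some (xs[(LEAST k. k < length xs \<and> xs ! k = i - 1) := i])
     else None"
  by (auto dest!: set_update_subset_insert[THEN subsetD])

text \<open>\<open>left_adds [i\<^sub>1, \<dots>, i\<^sub>m] \<alpha>\<close> is \<open>t\<^bsub>i\<^sub>m\<^esub> \<cdots> t\<^bsub>i\<^sub>1\<^esub> (\<alpha>)\<close>.\<close>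

definition left_adds :: "nat list \<Rightarrow> composition \<Rightarrow> composition option" where
  "left_adds is \<alpha> = fold (\<lambda>i x. Option.bind x (left_add i)) is (Some \<alpha>)"

definition LH :: "nat \<Rightarrow> composition \<Rightarrow> composition \<Rightarrow> bool" where
  "LH m \<alpha> \<beta> \<longleftrightarrow> (\<exists>is. length is = m \<and> (\<forall>i\<in>set is. 1 \<le> i) \<and>
     sorted_wrt (<) is \<and> left_adds is \<alpha> = Some \<beta>)"

definition LV :: "nat \<Rightarrow> composition \<Rightarrow> composition \<Rightarrow> bool" where
  "LV m \<alpha> \<beta> \<longleftrightarrow> (\<exists>is. length is = m \<and> (\<forall>i\<in>set is. 1 \<le> i) \<and>
     sorted_wrt (\<ge>) is \<and> left_adds is \<alpha> = Some \<beta>)"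

lemma LH_0: "LH 0 \<alpha> \<beta> \<longleftrightarrow> \<alpha> = \<beta>" and LV_0: "LV 0 \<alpha> \<beta> \<longleftrightarrow> \<alpha> = \<beta>"
  by (auto simp: LH_def LV_def left_adds_def)

text \<open>Each step adds one to the size, so the sums over left strips are finite.\<close>

lemma left_add_size:
  "left_add i \<alpha> = Some \<beta> \<Longrightarrow> sum_list (parts \<beta>) = Suc (sum_list (parts \<alpha>))"
proof (transfer, goal_cases)
  case (1 i xs ys)
  show ?case
  proof (cases "i = 1")
    case True
    with 1 show ?thesis by auto
  next
    case False
    define k where "k = (LEAST k. k < length xs \<and> xs ! k = i - 1)"
    have i: "2 \<le> i" "i - 1 \<in> set xs" and ys: "ys = xs[k := i]"
      using 1 False by (auto simp: k_def split: if_splits)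
    have k: "k < length xs \<and> xs ! k = i - 1"
      unfolding k_def by (rule LeastI_ex) (use i(2) in \<open>simp add: in_set_conv_nth\<close>)
    then have "i - 1 \<le> sum_list xs" using elem_le_sum_list by metis
    with k i(1) ys show ?thesis by (simp add: sum_list_update)
  qed
qed

lemma left_adds_size:
  "left_adds is \<alpha> = Some \<beta> \<Longrightarrow> sum_list (parts \<beta>) = sum_list (parts \<alpha>) + length is"
proof (induction "is" arbitrary: \<beta> rule: rev_induct)
  case Nil
  then show ?case by (simp add: left_adds_def)
next
  case (snoc i js)
  then obtain \<gamma> where "left_adds js \<alpha> = Some \<gamma>" "left_add i \<gamma> = Some \<beta>"
    by (auto simp: left_adds_def bind_eq_Some_conv)
  then show ?case using snoc.IH left_add_size by simp
qed

lemma finite_composition_size: "finite {\<alpha>. sum_list (parts \<alpha>) \<le> n}"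
proof (rule finite_imageD)
  have "parts ` {\<alpha>. sum_list (parts \<alpha>) \<le> n} \<subseteq> {xs. set xs \<subseteq> {..n} \<and> length xs \<le> n}"
  proof (clarsimp, intro conjI subsetI)
    fix \<alpha> assume le: "sum_list (parts \<alpha>) \<le> n"
    show "x \<in> {..n}" if "x \<in> set (parts \<alpha>)" for x
      using member_le_sum_list[OF that] le by simp
    have "sum_list (map (\<lambda>_. 1) (parts \<alpha>)) \<le> sum_list (map (\<lambda>x. x) (parts \<alpha>))"
      by (rule sum_list_mono) (use parts[of \<alpha>] in auto)
    then show "length (parts \<alpha>) \<le> n" using le by (simp add: sum_list_triv)
  qed
  then show "finite (parts ` {\<alpha>. sum_list (parts \<alpha>) \<le> n})"
    by (rule finite_subset) (rule finite_lists_length_le, simp)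
  show "inj_on parts {\<alpha>. sum_list (parts \<alpha>) \<le> n}"
    by (simp add: inj_on_def parts_inject)
qed

lemma finite_strip_pairs:
  "finite {(\<rho>, \<mu>). LH a \<Lambda> \<rho> \<and> LV b \<mu> \<eta>}" "finite {(\<rho>, \<mu>). LV a \<Lambda> \<rho> \<and> LH b \<mu> \<eta>}"
  by (rule finite_subset[OF _ finite_cartesian_product[OF
        finite_composition_size[of "sum_list (parts \<Lambda>) + a"] finite_composition_size[of "sum_list (parts \<eta>)"]]],
      auto simp: LH_def LV_def dest: left_adds_size)+

end

theory Submission
  imports Defs "HOL-Computational_Algebra.Formal_Power_Series"
begin

text \<open>Deleting the entries 1 of a filling leaves a filling whose shape differs by a left horizontal
  strip. Dually this is the Pieri rule \<open>H\<^sub>n s\<^sub>\<lambda> = \<Sum>s\<^sub>\<rho>\<close> over \<open>\<lambda> \<rightarrow>\<^sup>L\<^sup>H \<rho>\<close>. A sign-reversing involution on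
  words, which moves the smallest letter between a decreasing prefix and an increasing suffix,
  turns it into the Pieri rule for \<open>E\<^sub>n = s\<^sub>1\<^sub>.\<^sub>.\<^sub>1\<close> and left vertical strips, and shows
  that \<open>\<Sum>E\<^sub>n(-t)\<^sup>n\<close> is inverse to \<open>\<Sum>H\<^sub>nt\<^sup>n\<close>. Hence
  \<open>H\<^sub>n \<otimes> 1 = \<Sum>(-1)\<^sup>b (1 \<otimes> E\<^sub>b) \<Delta>(H\<^sub>a)\<close>, summed over \<open>a + b = n\<close>. Multiplying by \<open>\<Delta>(s\<^sub>\<lambda>)\<close> and pairing
  the right tensor factor with \<open>\<S>\<^sub>\<eta>\<close> gives the first identity; exchanging \<open>H\<close> and \<open>E\<close> gives the second.\<close>

text \<open>Multiplying \<open>H_\<alpha>\<close> on the left by \<open>H_n\<close> prepends n to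
  the content, so it prescribes the number of smallest entries; this is why the entries 1 are the
  ones deleted, and why a new row can only appear on top. Both the dual basis and the skew elements
  are given by definite descriptions, so existence and uniqueness have to be proved. Counting
  fillings gives only the adjoint of multiplication by \<open>H_n\<close>. Solving the expected
  Pieri rule for its leading term defines candidates; the count then shows that they are dual to the
  quasisymmetric Schur functions, and used once more it expands every \<open>H_\<alpha>\<close> in
  them, so that the pairing is nondegenerate. The coproduct of a column is never computed: columns
  enter as the inverse of the row series, and multiplicativity of \<Delta> carries this inversion
  over to NSym \<otimes> NSym. As NSym is not commutative, left and right inverses must be
  identified separately, and the only commutation available is that of g \<otimes> 1 with 1
  \<otimes> h.\<close>

section \<open>Left horizontal strips\<close>

text \<open>The strip \<open>Y - X\<close> is described box by box: a new box in column \<open>p\<close> of row \<open>j\<close> requires of every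
  higher row \<open>i\<close> that it ends before column \<open>p - 1\<close> in \<open>Y\<close> or already reaches column \<open>p\<close> in \<open>X\<close>. The
  inner shape \<open>X\<close> carries a leading part 0 when \<open>t\<^sub>1\<close> creates a new first row.\<close>

definition hstrip :: "nat list \<Rightarrow> nat list \<Rightarrow> bool" where
  "hstrip X Y \<longleftrightarrow> length X = length Y \<and> (\<forall>i<length Y. X ! i \<le> Y ! i) \<and>
     (\<forall>i j p. i < j \<and> j < length Y \<and> X ! j < p \<and> p \<le> Y ! j \<longrightarrow> Suc (Y ! i) < p \<or> p \<le> X ! i)"

lemma hstrip_length: "hstrip X Y \<Longrightarrow> length X = length Y"
  by (simp add: hstrip_def)

lemma hstrip_le: "hstrip X Y \<Longrightarrow> i < length Y \<Longrightarrow> X ! i \<le> Y ! i"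
  by (simp add: hstrip_def)

lemma hstripD:
  "hstrip X Y \<Longrightarrow> i < j \<Longrightarrow> j < length Y \<Longrightarrow> X ! j < p \<Longrightarrow> p \<le> Y ! j \<Longrightarrow> Suc (Y ! i) < p \<or> p \<le> X ! i"
  unfolding hstrip_def by blast

lemma hstrip_refl: "hstrip X X"
  by (auto simp: hstrip_def)

lemma hstrip_add_row: "hstrip (0 # X) (n # X)"
  unfolding hstrip_def by (auto simp: nth_Cons')

lemma left_add_1: "left_add 1 \<alpha> = Some \<beta> \<longleftrightarrow> parts \<beta> = 1 # parts \<alpha>"
  by transfer auto

lemma left_add_Some_iff:
  assumes "i \<noteq> 1"
  shows "left_add i \<alpha> = Some \<beta> \<longleftrightarrow> (\<exists>k<length (parts \<alpha>). 2 \<le> i \<and> parts \<alpha> ! k = i - 1 \<and>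
    (\<forall>l<k. parts \<alpha> ! l \<noteq> i - 1) \<and> parts \<beta> = (parts \<alpha>)[k := i])"
  using assms
proof (transfer, goal_cases)
  case (1 i xs ys)
  let ?P = "\<lambda>k. k < length xs \<and> xs ! k = i - 1"
  have L: "Least ?P = k" if "?P k" "\<forall>l<k. xs ! l \<noteq> i - 1" for k
    by (rule Least_equality) (use that in \<open>auto simp: not_less[symmetric]\<close>)
  show ?case
  proof
    assume A: "(if i = 1 then Some (1 # xs) else if 2 \<le> i \<and> i - 1 \<in> set xs
          then Some (xs[Least ?P := i]) else None) = Some ys"
    with 1 have i: "2 \<le> i" "i - 1 \<in> set xs" and ys: "ys = xs[Least ?P := i]"
      by (auto split: if_splits)
    have "?P (Least ?P)"
      by (rule LeastI_ex) (use i(2) in \<open>simp add: in_set_conv_nth\<close>)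
    moreover have "xs ! l \<noteq> i - 1" if "l < Least ?P" for l
      using not_less_Least[OF that] that calculation by auto
    ultimately show "\<exists>k<length xs. 2 \<le> i \<and> xs ! k = i - 1 \<and> (\<forall>l<k. xs ! l \<noteq> i - 1) \<and> ys = xs[k := i]"
      using i ys by blast
  next
    assume "\<exists>k<length xs. 2 \<le> i \<and> xs ! k = i - 1 \<and> (\<forall>l<k. xs ! l \<noteq> i - 1) \<and> ys = xs[k := i]"
    then obtain k where k: "k < length xs" "2 \<le> i" "xs ! k = i - 1" "\<forall>l<k. xs ! l \<noteq> i - 1" "ys = xs[k := i]"
      by blast
    then have "i - 1 \<in> set xs" by (metis nth_mem)
    with k L[of k] 1 show "(if i = 1 then Some (1 # xs) else if 2 \<le> i \<and> i - 1 \<in> set xs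
          then Some (xs[Least ?P := i]) else None) = Some ys" by simp
  qed
qed

lemma left_adds_Nil [simp]: "left_adds [] \<alpha> = Some \<alpha>"
  by (simp add: left_adds_def)

lemma left_adds_append: "left_adds (is @ js) \<alpha> = Option.bind (left_adds is \<alpha>) (left_adds js)"
proof -
  have "fold (\<lambda>i x. Option.bind x (left_add i)) js None = None" for js
    by (induction js) auto
  then show ?thesis
    by (cases "left_adds is \<alpha>") (simp_all add: left_adds_def)
qed

lemma left_adds_single: "left_adds [i] \<alpha> = left_add i \<alpha>"
  by (simp add: left_adds_def)

lemma left_adds_snoc: "left_adds (is @ [i]) \<alpha> = Option.bind (left_adds is \<alpha>) (left_add i)"
  by (cases "left_adds is \<alpha>") (simp_all add: left_adds_append left_adds_single)

lemma parts_nth_pos: "i < length (parts \<alpha>) \<Longrightarrow> 1 \<le> parts \<alpha> ! i"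
  using parts_pos[of i \<alpha>] by simp

text \<open>The last conjunct drives the induction over the last, largest letter i: grown rows end
  in earlier letters, so every box added so far lies in a column below i. Rows above the one
  extended by \<open>t_i\<close> do not have length i - 1, because the leftmost such part is chosen;
  those that reach column i therefore do so already in X.\<close>

lemma left_adds_imp_hstrip:
  assumes "sorted_wrt (<) is" "\<forall>i\<in>set is. 1 \<le> i" "left_adds is \<alpha> = Some \<beta>"
  shows "\<exists>X\<in>{parts \<alpha>, 0 # parts \<alpha>}. hstrip X (parts \<beta>) \<and>
    (\<forall>j<length X. X ! j < parts \<beta> ! j \<longrightarrow> parts \<beta> ! j \<in> set is)"
  using assms
proof (induction "is" arbitrary: \<beta> rule: rev_induct)
  case Nil
  then show ?case by (auto simp: hstrip_refl)
next
  case (snoc i js)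
  obtain \<gamma> where \<gamma>: "left_adds js \<alpha> = Some \<gamma>" "left_add i \<gamma> = Some \<beta>"
    using snoc.prems(3) by (auto simp: left_adds_snoc bind_eq_Some_conv)
  have js: "sorted_wrt (<) js" "\<forall>j\<in>set js. j < i"
    using snoc.prems(1) by (auto simp: sorted_wrt_append)
  obtain X where X: "X \<in> {parts \<alpha>, 0 # parts \<alpha>}" "hstrip X (parts \<gamma>)"
      "\<forall>j<length X. X ! j < parts \<gamma> ! j \<longrightarrow> parts \<gamma> ! j \<in> set js"
    using snoc.IH[OF js(1) _ \<gamma>(1)] snoc.prems(2) unfolding set_append by blast
  show ?case
  proof (cases "i = 1")
    case True
    \<comment> \<open>Letters are positive and strictly increasing, so \<open>t_1\<close> can only
      come first.\<close>
    then have "js = []" using js(2) snoc.prems(2) by (cases js) auto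
    then have "\<gamma> = \<alpha>" using \<gamma> by simp
    then have \<beta>: "parts \<beta> = 1 # parts \<alpha>" using \<gamma>(2) True left_add_1 by simp
    show ?thesis
      unfolding \<beta> by (rule bexI[of _ "0 # parts \<alpha>"]) (auto simp: hstrip_add_row True nth_Cons')
  next
    case False
    then obtain k where k: "k < length (parts \<gamma>)" "2 \<le> i" "parts \<gamma> ! k = i - 1"
        "\<forall>l<k. parts \<gamma> ! l \<noteq> i - 1" "parts \<beta> = (parts \<gamma>)[k := i]"
      using left_add_Some_iff \<gamma>(2) by blast
    have len: "length X = length (parts \<gamma>)" using X(2) hstrip_length by blast
    have added: "p < i" if "j < length X" "X ! j < p" "p \<le> parts \<gamma> ! j" for j p
    proof -
      have "parts \<gamma> ! j \<in> set js" using that X(3) by simp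
      then show ?thesis using js(2) that(3) by fastforce
    qed
    have "hstrip X (parts \<beta>)"
      unfolding hstrip_def
    proof (intro conjI allI impI, goal_cases)
      case 1
      show ?case using len k by simp
    next
      case (2 l)
      then have "X ! l \<le> parts \<gamma> ! l" using hstrip_le[OF X(2)] k by simp
      then show ?case using k by (cases "l = k") auto
    next
      case (3 l j p)
      then have lj: "l < j" "j < length (parts \<gamma>)" "X ! j < p" "p \<le> parts \<beta> ! j"
        using k by auto
      show ?case
      proof (cases "j = k \<and> p = i")
        case True
        have "parts \<gamma> ! l < i - 1 \<or> i \<le> parts \<gamma> ! l" using k(4) True lj(1) by force
        moreover have "i \<le> X ! l" if "i \<le> parts \<gamma> ! l"
          using added[of l i] lj that len by force
        ultimately show ?thesis using True lj k by (auto simp: nth_list_update)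
      next
        case False
        then have p: "p \<le> parts \<gamma> ! j" using lj k by (auto simp: nth_list_update split: if_splits)
        then have "Suc (parts \<gamma> ! l) < p \<or> p \<le> X ! l"
          using hstripD[OF X(2) lj(1,2,3)] by simp
        moreover have "p < i" using added lj p len by simp
        \<comment> \<open>If l = k, the higher row itself has just grown to column i; as p < i, the
          alternative p \<le> X ! l was the one that held, and it survives.\<close>
        ultimately show ?thesis using k by (cases "l = k") (auto simp: nth_list_update)
      qed
    qed
    moreover have "\<forall>j<length X. X ! j < parts \<beta> ! j \<longrightarrow> parts \<beta> ! j \<in> set (js @ [i])"
      using X(3) k len by (auto simp: nth_list_update)
    ultimately show ?thesis using X(1) by blast
  qed
qed

text \<open>The word is rebuilt from its last letter by peeling off the rightmost added box. The
  strip condition makes the column p of this box unique among the ends of grown rows, and the bound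
  on the letters in the conclusion keeps the word of the smaller strip below p.\<close>

lemma hstrip_imp_left_adds:
  assumes "X \<in> {parts \<alpha>, 0 # parts \<alpha>}" "hstrip X (parts \<beta>)" "sum_list (parts \<beta>) = sum_list X + n"
  shows "\<exists>is. length is = n \<and> (\<forall>i\<in>set is. 1 \<le> i) \<and> sorted_wrt (<) is \<and> left_adds is \<alpha> = Some \<beta> \<and>
    (\<forall>i\<in>set is. \<exists>j<length X. X ! j < parts \<beta> ! j \<and> i \<le> parts \<beta> ! j)"
  using assms(2,3)
proof (induction n arbitrary: \<beta>)
  case 0
  have len: "length X = length (parts \<beta>)" using 0 hstrip_length by blast
  have "parts \<beta> ! i = X ! i" if "i < length X" for i
  proof (rule ccontr)
    assume "parts \<beta> ! i \<noteq> X ! i"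
    then have "sum_list X < sum_list (parts \<beta>)"
      unfolding sum_list_sum_nth len
      by (intro sum_strict_mono_ex1) (use hstrip_le[OF 0(1)] that len in \<open>auto intro!: bexI[of _ i] simp: le_neq_implies_less\<close>)
    then show False using 0 by simp
  qed
  then have eq: "X = parts \<beta>" using len by (simp add: nth_equalityI)
  \<comment> \<open>A leading 0 in X is excluded because the parts of \<beta> are positive.\<close>
  have "X = parts \<alpha>" using assms(1) eq parts[of \<beta>] by auto
  then have "\<alpha> = \<beta>" using eq by (simp add: parts_inject)
  then show ?case by (intro exI[of _ "[]"]) auto
next
  case (Suc n)
  have len: "length X = length (parts \<beta>)" using Suc hstrip_length by blast
  let ?A = "{j. j < length X \<and> X ! j < parts \<beta> ! j}"
  have "?A \<noteq> {}"
  proof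
    assume "?A = {}"
    then have "sum_list (parts \<beta>) \<le> sum_list X"
      unfolding sum_list_sum_nth len by (intro sum_mono) (use len in force)
    then show False using Suc.prems by simp
  qed
  then have "Max ((!) (parts \<beta>) ` ?A) \<in> (!) (parts \<beta>) ` ?A"
    by (intro Max_in) auto
  then obtain j where j: "j \<in> ?A" and "Max ((!) (parts \<beta>) ` ?A) = parts \<beta> ! j" by auto
  then have jmax: "parts \<beta> ! l \<le> parts \<beta> ! j" if "l \<in> ?A" for l
    using Max_ge[of "(!) (parts \<beta>) ` ?A" "parts \<beta> ! l"] that by auto
  define p where "p = parts \<beta> ! j"
  have jl: "j < length (parts \<beta>)" and Xj: "X ! j < p" using j len by (auto simp: p_def)
  \<comment> \<open>If two grown rows both ended in column p, the lower one would violate the strip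
    condition against the upper one, which reaches column p in \<beta> but not in X.\<close>
  have uniq: "parts \<beta> ! l < p" if l: "l \<in> ?A" "l \<noteq> j" for l
  proof (rule ccontr)
    assume "\<not> parts \<beta> ! l < p"
    then have eq: "parts \<beta> ! l = p" using jmax[OF l(1)] p_def by simp
    consider "l < j" | "j < l" using l(2) by linarith
    then show False
    proof cases
      case 1
      then show False using hstripD[OF Suc.prems(1) 1 jl Xj] eq l p_def by auto
    next
      case 2
      then show False using hstripD[OF Suc.prems(1) 2, of p] eq l p_def len Xj by auto
    qed
  qed
  show ?case
  proof (cases "p = 1")
    case True
    \<comment> \<open>The parts of \<alpha> are positive, so a new box in column 1 lies in the new
      first row; by the choice of p no other row has grown.\<close>
    then have X0: "X ! j = 0" using Xj by simp
    then have X: "X = 0 # parts \<alpha>"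
      using assms(1) parts_nth_pos[of j \<alpha>] jl len by auto
    with X0 jl len have j0: "j = 0" using parts_nth_pos[of "j - 1" \<alpha>] by (cases j) auto
    have "parts \<beta> ! l = X ! l" if "l < length X" "l \<noteq> 0" for l
    proof (rule ccontr)
      assume "parts \<beta> ! l \<noteq> X ! l"
      then have "l \<in> ?A" using that hstrip_le[OF Suc.prems(1)] len by (simp add: le_neq_implies_less)
      then show False using uniq[of l] that True j0 by auto
    qed
    moreover have "parts \<beta> ! 0 = 1" using True j0 p_def by simp
    ultimately have Y: "parts \<beta> = 1 # parts \<alpha>"
      using len X by (intro nth_equalityI) (auto simp: nth_Cons' )
    then have "n = 0" using Suc.prems(2) X by simp
    moreover have "left_adds [1] \<alpha> = Some \<beta>" using Y left_add_1 by (simp add: left_adds_single)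
    ultimately show ?thesis
      using jl Y len X by (intro exI[of _ "[1]"]) auto
  next
    case False
    then have p: "2 \<le> p" using Xj by simp
    define Z where "Z = (parts \<beta>)[j := p - 1]"
    have "\<forall>x\<in>set Z. 0 < x"
      using parts[of \<beta>] p unfolding Z_def by (auto dest!: set_update_subset_insert[THEN subsetD])
    then have PZ: "parts (Composition Z) = Z" by (simp add: Composition_inverse)
    have lenZ: "length Z = length X" by (simp add: Z_def len)
    have Zj: "Z ! j = p - 1" using jl by (simp add: Z_def)
    have Zl: "Z ! l = parts \<beta> ! l" if "l \<noteq> j" for l using that by (simp add: Z_def)
    have hs: "hstrip X Z"
      unfolding hstrip_def
    proof (intro conjI allI impI, goal_cases)
      case 1
      then show ?case by (simp add: lenZ)
    next
      case (2 i)
      then show ?case using hstrip_le[OF Suc.prems(1), of i] Xj Zj Zl[of i] lenZ len by (cases "i = j") auto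
    next
      case (3 i l q)
      then have il: "i < l" "l < length (parts \<beta>)" "X ! l < q" "q \<le> Z ! l" using lenZ len by auto
      have q: "q \<le> parts \<beta> ! l" using il Zj Zl[of l] p_def by (cases "l = j") auto
      have *: "Suc (parts \<beta> ! i) < q \<or> q \<le> X ! i" using hstripD[OF Suc.prems(1) il(1,2,3) q] .
      show ?case
      proof (cases "i = j")
        case True
        have "q \<le> p" using jmax[of l] il q len p_def by simp
        then show ?thesis using * True p_def by auto
      next
        case False
        then show ?thesis using * Zl by simp
      qed
    qed
    have sumZ: "sum_list (parts \<beta>) = Suc (sum_list Z)"
    proof -
      have "p \<le> sum_list (parts \<beta>)" unfolding p_def using elem_le_sum_list[OF jl] .
      then show ?thesis unfolding Z_def using jl p by (simp add: sum_list_update p_def)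
    qed
    then have "sum_list Z = sum_list X + n" using Suc.prems(2) by simp
    then obtain "is" where i: "length is = n" "\<forall>i\<in>set is. 1 \<le> i" "sorted_wrt (<) is"
        "left_adds is \<alpha> = Some (Composition Z)"
        "\<forall>i\<in>set is. \<exists>j<length X. X ! j < Z ! j \<and> i \<le> Z ! j"
      using Suc.IH[of "Composition Z"] hs unfolding PZ by blast
    have lt: "i < p" if i_mem: "i \<in> set is" for i
    proof -
      obtain l where l: "l < length X" "X ! l < Z ! l" "i \<le> Z ! l"
        using i(5) i_mem by blast
      show ?thesis
      proof (cases "l = j")
        case True
        then show ?thesis using l Zj p by simp
      next
        case False
        then show ?thesis using uniq[of l] l Zl by simp
      qed
    qed
    \<comment> \<open>Row j is the leftmost part equal to p - 1: the strip condition at the removed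
      box says that each higher row ends before column p - 1 or reaches column p.\<close>
    have "left_add p (Composition Z) = Some \<beta>"
    proof (subst left_add_Some_iff[OF False], intro exI[of _ j] conjI)
      show "\<forall>l<j. parts (Composition Z) ! l \<noteq> p - 1"
      proof (intro allI impI)
        fix l assume l: "l < j"
        have "Suc (parts \<beta> ! l) < p \<or> p \<le> X ! l"
          using hstripD[OF Suc.prems(1) l jl Xj] p_def by simp
        moreover have "X ! l \<le> parts \<beta> ! l" using hstrip_le[OF Suc.prems(1)] l jl by simp
        ultimately show "parts (Composition Z) ! l \<noteq> p - 1" using PZ Zl l p by auto
      qed
    qed (use PZ jl p Zj in \<open>auto simp: Z_def p_def\<close>)
    then have adds: "left_adds (is @ [p]) \<alpha> = Some \<beta>" using i(4) by (simp add: left_adds_snoc)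
    have le: "i \<le> p" if "i \<in> set (is @ [p])" for i
      using that lt[of i] by auto
    have "\<forall>i\<in>set (is @ [p]). \<exists>j<length X. X ! j < parts \<beta> ! j \<and> i \<le> parts \<beta> ! j"
      using j le unfolding p_def by blast
    moreover have "sorted_wrt (<) (is @ [p])"
      using i(3) lt by (simp add: sorted_wrt_append)
    moreover have "\<forall>i\<in>set (is @ [p]). 1 \<le> i" "length (is @ [p]) = Suc n"
      using i(1,2) p by simp_all
    ultimately show ?thesis using adds by (intro exI[of _ "is @ [p]"] conjI)
  qed
qed

text \<open>The two candidates for X record whether \<open>t_1\<close> is applied, which happens at
  most once in a strictly increasing word.\<close>

lemma LH_iff:
  "LH n \<alpha> \<beta> \<longleftrightarrow> (\<exists>X\<in>{parts \<alpha>, 0 # parts \<alpha>}. hstrip X (parts \<beta>) \<and> sum_list (parts \<beta>) = sum_list X + n)"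
proof
  assume "LH n \<alpha> \<beta>"
  then obtain "is" where i: "length is = n" "\<forall>i\<in>set is. 1 \<le> i" "sorted_wrt (<) is" "left_adds is \<alpha> = Some \<beta>"
    unfolding LH_def by blast
  show "\<exists>X\<in>{parts \<alpha>, 0 # parts \<alpha>}. hstrip X (parts \<beta>) \<and> sum_list (parts \<beta>) = sum_list X + n"
  proof -
    obtain X where X: "X \<in> {parts \<alpha>, 0 # parts \<alpha>}" "hstrip X (parts \<beta>)"
      using left_adds_imp_hstrip[OF i(3,2,4)] by blast
    moreover have "sum_list X = sum_list (parts \<alpha>)" using X(1) by auto
    ultimately show ?thesis using left_adds_size[OF i(4)] i(1) by (intro bexI[of _ X]) simp_all
  qed
next
  assume "\<exists>X\<in>{parts \<alpha>, 0 # parts \<alpha>}. hstrip X (parts \<beta>) \<and> sum_list (parts \<beta>) = sum_list X + n"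
  then show "LH n \<alpha> \<beta>" using hstrip_imp_left_adds unfolding LH_def by blast
qed

section \<open>Fillings with prescribed content\<close>

definition row_fillings :: "nat list \<Rightarrow> (nat \<Rightarrow> nat \<Rightarrow> nat) set" where
  "row_fillings xs = {T. (\<forall>i c. 0 < T i c \<longleftrightarrow> i < length xs \<and> c < xs ! i) \<and>
     (\<forall>i c. T i (Suc c) \<le> T i c) \<and>
     (\<forall>i j. i < j \<and> j < length xs \<longrightarrow> T i 0 < T j 0) \<and>
     (\<forall>i j c. i < j \<and> 0 < T j (Suc c) \<and> T i (Suc c) \<le> T j (Suc c) \<longrightarrow> T i c < T j (Suc c))}"

lemma fillings_eq_row_fillings: "fillings \<alpha> = row_fillings (parts \<alpha>)"
proof (rule set_eqI)
  fix T :: "nat \<Rightarrow> nat \<Rightarrow> nat"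
  have "(\<forall>i c. (i, Suc c) \<in> diagram \<alpha> \<longrightarrow> T i (Suc c) \<le> T i c) \<longleftrightarrow> (\<forall>i c. T i (Suc c) \<le> T i c)"
    if "\<forall>i c. 0 < T i c \<longleftrightarrow> (i, c) \<in> diagram \<alpha>"
  proof -
    have "T i (Suc c) \<le> T i c" if "(i, Suc c) \<notin> diagram \<alpha>" for i c
      using \<open>\<forall>i c. 0 < T i c \<longleftrightarrow> (i, c) \<in> diagram \<alpha>\<close> that by (metis le0 not_gr0)
    then show ?thesis by blast
  qed
  moreover have "(j < length (parts \<alpha>) \<and> T j (Suc c) \<noteq> 0) \<longleftrightarrow> 0 < T j (Suc c)"
    if "\<forall>i c. 0 < T i c \<longleftrightarrow> (i, c) \<in> diagram \<alpha>" for j c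
    using that by (auto simp: diagram_def)
  ultimately show "T \<in> fillings \<alpha> \<longleftrightarrow> T \<in> row_fillings (parts \<alpha>)"
    unfolding fillings_def row_fillings_def mem_Collect_eq by (auto simp: diagram_def)
qed

definition entry_count :: "(nat \<Rightarrow> nat \<Rightarrow> nat) \<Rightarrow> nat \<Rightarrow> nat" where
  "entry_count T v = card {(i, c). T i c = v}"

definition content_fillings :: "nat list \<Rightarrow> nat list \<Rightarrow> (nat \<Rightarrow> nat \<Rightarrow> nat) set" where
  "content_fillings xs as = {T \<in> row_fillings xs.
     \<forall>v. entry_count T (Suc v) = (if v < length as then as ! v else 0)}"

definition boxes :: "nat list \<Rightarrow> (nat \<times> nat) set" where
  "boxes xs = (SIGMA i:{..<length xs}. {..<xs ! i})"

lemma finite_boxes [simp]: "finite (boxes xs)"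
  by (simp add: boxes_def)

lemma card_boxes: "card (boxes xs) = sum_list xs"
  by (simp add: boxes_def sum_list_sum_nth atLeast0LessThan)

lemma row_fillings_pos: "T \<in> row_fillings xs \<Longrightarrow> 0 < T i c \<longleftrightarrow> (i, c) \<in> boxes xs"
  by (auto simp: row_fillings_def boxes_def)

lemma row_fillings_decr: "T \<in> row_fillings xs \<Longrightarrow> c \<le> d \<Longrightarrow> T i d \<le> T i c"
  by (rule lift_Suc_antimono_le[of "T i"]) (auto simp: row_fillings_def)

lemma row_fillings_first_column:
  "T \<in> row_fillings xs \<Longrightarrow> i < j \<Longrightarrow> j < length xs \<Longrightarrow> T i 0 < T j 0"
  by (simp add: row_fillings_def)

lemma row_fillings_triple:
  "T \<in> row_fillings xs \<Longrightarrow> i < j \<Longrightarrow> 0 < T j (Suc c) \<Longrightarrow> T i (Suc c) \<le> T j (Suc c) \<Longrightarrow>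
     T i c < T j (Suc c)"
  unfolding row_fillings_def by blast

lemma row_fillingsI:
  assumes "\<And>i c. 0 < T i c \<longleftrightarrow> (i, c) \<in> boxes xs"
    and "\<And>i c. T i (Suc c) \<le> T i c"
    and "\<And>i j. i < j \<Longrightarrow> j < length xs \<Longrightarrow> T i 0 < T j 0"
    and "\<And>i j c. i < j \<Longrightarrow> 0 < T j (Suc c) \<Longrightarrow> T i (Suc c) \<le> T j (Suc c) \<Longrightarrow> T i c < T j (Suc c)"
  shows "T \<in> row_fillings xs"
  using assms unfolding row_fillings_def boxes_def mem_Collect_eq mem_Sigma_iff lessThan_iff by blast

lemma lookup_filling_monomial:
  assumes "T \<in> fillings \<beta>"
  shows "Poly_Mapping.lookup (filling_monomial \<beta> T) v = (if v = 0 then 0 else entry_count T v)"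
proof -
  have D: "diagram \<beta> = boxes (parts \<beta>)" by (auto simp: diagram_def boxes_def)
  have pos: "0 < T i c \<longleftrightarrow> (i, c) \<in> boxes (parts \<beta>)" for i c
    using assms row_fillings_pos fillings_eq_row_fillings by blast
  have "Poly_Mapping.lookup (filling_monomial \<beta> T) v
      = (\<Sum>p\<in>boxes (parts \<beta>). if case_prod T p = v then 1 else 0)"
    unfolding filling_monomial_def lookup_sum D
    by (rule sum.cong) (auto simp: lookup_single when_def)
  also have "\<dots> = card {p \<in> boxes (parts \<beta>). case_prod T p = v}"
    by (simp add: sum.If_cases Int_def)
  also have "{p \<in> boxes (parts \<beta>). case_prod T p = v} = (if v = 0 then {} else {(i, c). T i c = v})"
    using pos by (auto simp: gr0_conv_Suc split: prod.splits)
  finally show ?thesis by (simp add: entry_count_def)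
qed

lemma lookup_initial_monomial:
  "Poly_Mapping.lookup (initial_monomial \<alpha>) v =
     (if v \<noteq> 0 \<and> v - 1 < length (parts \<alpha>) then parts \<alpha> ! (v - 1) else 0)"
proof -
  let ?is = "[1..<Suc (length (parts \<alpha>))]"
  show ?thesis
  proof (cases "v \<noteq> 0 \<and> v - 1 < length (parts \<alpha>)")
    case True
    then have "?is ! (v - 1) = v" using nth_upt[of 1 "v - 1" "Suc (length (parts \<alpha>))"] by auto
    then show ?thesis
      using lookup_power_monomial[of ?is \<alpha> "v - 1"] True
      by (simp add: initial_monomial_def del: upt_Suc)
  next
    case False
    then have "v \<notin> Poly_Mapping.keys (initial_monomial \<alpha>)"
      using keys_power_monomial[of ?is \<alpha>]
      by (auto simp: initial_monomial_def simp del: upt_Suc)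
    then show ?thesis using False by (auto simp: in_keys_iff)
  qed
qed

lemma qsym_schur_initial_monomial:
  "qsym_schur \<beta> (initial_monomial \<alpha>) = of_nat (card (content_fillings (parts \<beta>) (parts \<alpha>)))"
proof -
  have "filling_monomial \<beta> T = initial_monomial \<alpha> \<longleftrightarrow>
      (\<forall>v. entry_count T (Suc v) = (if v < length (parts \<alpha>) then parts \<alpha> ! v else 0))"
    if "T \<in> fillings \<beta>" for T
  proof -
    have "filling_monomial \<beta> T = initial_monomial \<alpha> \<longleftrightarrow> (\<forall>v. (if v = 0 then 0 else entry_count T v) =
        (if v \<noteq> 0 \<and> v - 1 < length (parts \<alpha>) then parts \<alpha> ! (v - 1) else 0))"
      unfolding poly_mapping_eq_iff fun_eq_iff lookup_initial_monomial lookup_filling_monomial[OF that] ..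
    also have "\<dots> \<longleftrightarrow> (\<forall>v. entry_count T (Suc v) = (if v < length (parts \<alpha>) then parts \<alpha> ! v else 0))"
      (is "(\<forall>v. ?f v = ?g v) \<longleftrightarrow> (\<forall>v. ?f' v = ?g' v)")
    proof (intro iffI allI)
      show "?f' v = ?g' v" if "\<forall>v. ?f v = ?g v" for v
        using spec[OF that, of "Suc v"] by simp
      show "?f v = ?g v" if "\<forall>v. ?f' v = ?g' v" for v
        using that by (cases v) simp_all
    qed
    finally show ?thesis .
  qed
  then have "{T \<in> fillings \<beta>. filling_monomial \<beta> T = initial_monomial \<alpha>} =
      content_fillings (parts \<beta>) (parts \<alpha>)"
    by (auto simp: content_fillings_def fillings_eq_row_fillings)
  then show ?thesis by (simp add: qsym_schur_def sum_of_monomials_def)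
qed

lemma finite_content_fillings: "finite (content_fillings xs as)"
proof -
  let ?S = "{f. \<forall>p. (p \<in> boxes xs \<longrightarrow> f p \<in> {..length as}) \<and> (p \<notin> boxes xs \<longrightarrow> f p = 0)}"
  have "case_prod T \<in> ?S" if T: "T \<in> content_fillings xs as" for T
  proof -
    have rT: "T \<in> row_fillings xs" using T by (simp add: content_fillings_def)
    have "T i c \<le> length as" for i c
    proof (rule ccontr)
      assume "\<not> T i c \<le> length as"
      then obtain v where v: "T i c = Suc v" "length as \<le> v" by (cases "T i c") auto
      \<comment> \<open>An infinite set has \<open>card\<close> 0 too, so finiteness must be known
        before a count of 0 shows that the value does not occur.\<close>
      have "{(i, c). T i c = Suc v} \<subseteq> boxes xs"
      proof (clarify)
        fix i c assume "T i c = Suc v"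
        then show "(i, c) \<in> boxes xs" using row_fillings_pos[OF rT, of i c] by simp
      qed
      then have "finite {(i, c). T i c = Suc v}" using finite_subset finite_boxes by blast
      moreover have "entry_count T (Suc v) = 0" using T v by (simp add: content_fillings_def)
      ultimately have "{(i, c). T i c = Suc v} = {}" by (simp add: entry_count_def)
      then show False using v by blast
    qed
    moreover have "T i c = 0" if "(i, c) \<notin> boxes xs" for i c
      using row_fillings_pos[OF rT, of i c] that by simp
    ultimately show ?thesis by auto
  qed
  then have "case_prod ` content_fillings xs as \<subseteq> ?S" by (rule image_subsetI)
  moreover have "finite ?S" by (rule finite_set_of_finite_funs) auto
  ultimately have "finite (case_prod ` content_fillings xs as)" by (rule finite_subset)
  then show ?thesis
    by (rule finite_imageD) (auto simp: inj_on_def fun_eq_iff)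
qed

text \<open>An empty row on top carries only zeros, so it asks of the rows below just that their
  first entries be positive; this is where positivity of the parts enters. The triple condition
  against a zero row holds automatically.\<close>

lemma card_content_fillings_zero_row:
  assumes "\<forall>x\<in>set xs. 0 < x"
  shows "card (content_fillings (0 # xs) as) = card (content_fillings xs as)"
proof (rule bij_betw_same_card)
  let ?up = "\<lambda>T i c. (case i of 0 \<Rightarrow> 0 | Suc i \<Rightarrow> T i c) :: nat"
  let ?down = "\<lambda>T i c. T (Suc i) c :: nat"
  have zero: "T 0 c = 0" if "T \<in> row_fillings (0 # xs)" for T c
    using row_fillings_pos[OF that, of 0 c] by (simp add: boxes_def)
  have down: "?down T \<in> row_fillings xs" if T: "T \<in> row_fillings (0 # xs)" for T
  proof (rule row_fillingsI)
    show "0 < T (Suc i) c \<longleftrightarrow> (i, c) \<in> boxes xs" for i c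
      using row_fillings_pos[OF T, of "Suc i" c] by (simp add: boxes_def)
    show "T (Suc i) (Suc c) \<le> T (Suc i) c" for i c
      by (rule row_fillings_decr[OF T]) simp
    show "T (Suc i) 0 < T (Suc j) 0" if "i < j" "j < length xs" for i j
      using row_fillings_first_column[OF T, of "Suc i" "Suc j"] that by simp
    show "T (Suc i) c < T (Suc j) (Suc c)"
      if "i < j" "0 < T (Suc j) (Suc c)" "T (Suc i) (Suc c) \<le> T (Suc j) (Suc c)" for i j c
      using row_fillings_triple[OF T _ that(2,3)] that(1) by simp
  qed
  have up: "?up T \<in> row_fillings (0 # xs)" if T: "T \<in> row_fillings xs" for T
  proof (rule row_fillingsI)
    show "0 < ?up T i c \<longleftrightarrow> (i, c) \<in> boxes (0 # xs)" for i c
      using row_fillings_pos[OF T, of "i - 1" c] by (cases i) (simp_all add: boxes_def)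
    show "?up T i (Suc c) \<le> ?up T i c" for i c
      by (cases i) (simp_all add: row_fillings_decr[OF T])
    show "?up T i 0 < ?up T j 0" if ij: "i < j" "j < length (0 # xs)" for i j
    proof -
      obtain j' where j': "j = Suc j'" using ij(1) by (cases j) auto
      show ?thesis
      proof (cases i)
        case 0
        have "(j', 0) \<in> boxes xs" using ij j' assms by (simp add: boxes_def)
        then have "0 < T j' 0" using row_fillings_pos[OF T] by blast
        then show ?thesis using 0 j' by simp
      next
        case (Suc i')
        then show ?thesis using row_fillings_first_column[OF T, of i' j'] ij j' by simp
      qed
    qed
    show "?up T i c < ?up T j (Suc c)"
      if ijc: "i < j" "0 < ?up T j (Suc c)" "?up T i (Suc c) \<le> ?up T j (Suc c)" for i j c
    proof -
      obtain j' where j': "j = Suc j'" using ijc(1) by (cases j) auto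
      show ?thesis
      proof (cases i)
        case 0
        then show ?thesis using ijc by simp
      next
        case (Suc i')
        then show ?thesis using row_fillings_triple[OF T, of i' j' c] ijc j' by simp
      qed
    qed
  qed
  have count: "entry_count (?up T) (Suc v) = entry_count T (Suc v)" for T v
  proof -
    have "{(i, c). ?up T i c = Suc v} = apfst Suc ` {(i, c). T i c = Suc v}"
      by (auto simp: image_iff gr0_conv_Suc split: nat.splits)
    moreover have "inj_on (apfst Suc :: nat \<times> nat \<Rightarrow> _) A" for A
      by (auto simp: inj_on_def)
    ultimately show ?thesis by (simp add: entry_count_def card_image)
  qed
  have up_down: "?up (?down T) = T" if "T \<in> row_fillings (0 # xs)" for T
    using zero[OF that] by (auto simp: fun_eq_iff split: nat.splits)
  show "bij_betw ?down (content_fillings (0 # xs) as) (content_fillings xs as)"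
  proof (rule bij_betw_byWitness[where f' = ?up])
    show "\<forall>T\<in>content_fillings (0 # xs) as. ?up (?down T) = T"
      using up_down by (auto simp: content_fillings_def)
    show "\<forall>T\<in>content_fillings xs as. ?down (?up T) = T" by simp
    show "?up ` content_fillings xs as \<subseteq> content_fillings (0 # xs) as"
      using up count by (auto simp: content_fillings_def)
    show "?down ` content_fillings (0 # xs) as \<subseteq> content_fillings xs as"
    proof (clarify)
      fix T assume T: "T \<in> content_fillings (0 # xs) as"
      then have "T \<in> row_fillings (0 # xs)" by (simp add: content_fillings_def)
      then show "?down T \<in> content_fillings xs as"
        using T down up_down count[of "?down T"] by (auto simp: content_fillings_def)
    qed
  qed
qed

section \<open>Deleting and restoring the entries 1\<close>

definition hstrip_inners :: "nat \<Rightarrow> nat list \<Rightarrow> nat list set" where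
  "hstrip_inners n ys = {X. hstrip X ys \<and> (\<forall>j. 0 < j \<and> j < length X \<longrightarrow> 0 < X ! j) \<and>
     sum_list ys = sum_list X + n}"

text \<open>A filling shows how long each row is but not whether an empty row is present: the shapes
  [] and [0] share the zero filling. Equal lengths rule this out.\<close>

lemma row_fillings_length_eq:
  assumes "T \<in> row_fillings xs" "T \<in> row_fillings ys" "length xs = length ys"
  shows "xs = ys"
proof (rule nth_equalityI[OF assms(3)])
  fix i assume i: "i < length xs"
  have "c < xs ! i \<longleftrightarrow> c < ys ! i" for c
    using row_fillings_pos[OF assms(1), of i c] row_fillings_pos[OF assms(2), of i c] i assms(3)
    by (simp add: boxes_def)
  then show "xs ! i = ys ! i" by (metis linorder_neqE_nat less_irrefl)
qed

lemma boxes_mono: "hstrip X Y \<Longrightarrow> boxes X \<subseteq> boxes Y"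
  using hstrip_le[of X Y] hstrip_length[of X Y] unfolding boxes_def by fastforce

lemma entry_count_1:
  assumes "hstrip X Y" "sum_list Y = sum_list X + n"
    and "\<And>i c. T i c = 1 \<longleftrightarrow> (i, c) \<in> boxes Y - boxes X"
  shows "entry_count T 1 = n"
proof -
  have "{(i, c). T i c = 1} = boxes Y - boxes X" using assms(3) by auto
  then have "entry_count T 1 = card (boxes Y - boxes X)" by (simp add: entry_count_def)
  also have "\<dots> = n"
    using boxes_mono[OF assms(1)] assms(2) by (simp add: card_Diff_subset card_boxes)
  finally show ?thesis .
qed

text \<open>Old entries are shifted by one and new boxes receive 1, so the strip condition is needed
  only for the triple condition at a new box. If the entry of a higher row i in the same column is
  at most 1, then row i of X does not reach that column, so by the strip condition row i of Y ends
  before the preceding one, where the value is thus 0.\<close>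

lemma add_ones_row_fillings:
  assumes T: "T \<in> row_fillings X" and hs: "hstrip X Y" and pos: "\<forall>y\<in>set Y. 0 < y"
  shows "(\<lambda>i c. T i c + of_bool ((i, c) \<in> boxes Y)) \<in> row_fillings Y" (is "?T \<in> _")
proof (rule row_fillingsI)
  have len: "length X = length Y" using hs by (rule hstrip_length)
  have sub: "boxes X \<subseteq> boxes Y" by (rule boxes_mono[OF hs])
  have T0: "T i c = 0" if "(i, c) \<notin> boxes X" for i c
    using row_fillings_pos[OF T, of i c] that by simp
  have T0Y: "T i c = 0" if "(i, c) \<notin> boxes Y" for i c
    using T0 sub that by blast
  show "0 < ?T i c \<longleftrightarrow> (i, c) \<in> boxes Y" for i c
    using row_fillings_pos[OF T, of i c] sub by auto
  show "?T i (Suc c) \<le> ?T i c" for i c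
    using row_fillings_decr[OF T, of c "Suc c" i] by (auto simp: boxes_def)
  show "?T i 0 < ?T j 0" if "i < j" "j < length Y" for i j
    using row_fillings_first_column[OF T, of i j] that pos len by (simp add: boxes_def)
  show "?T i c < ?T j (Suc c)" if ij: "i < j" and p: "0 < ?T j (Suc c)" and le: "?T i (Suc c) \<le> ?T j (Suc c)" for i j c
  proof -
    have Yj: "(j, Suc c) \<in> boxes Y" using p T0[of j "Suc c"] sub by (cases "(j, Suc c) \<in> boxes X") auto
    then have jY: "j < length Y" by (simp add: boxes_def)
    show ?thesis
    proof (cases "(j, Suc c) \<in> boxes X")
      case True
      then have "0 < T j (Suc c)" using row_fillings_pos[OF T] by blast
      moreover have "T i (Suc c) \<le> T j (Suc c)"
        using le Yj T0Y[of i "Suc c"] by (cases "(i, Suc c) \<in> boxes Y") auto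
      ultimately have "T i c < T j (Suc c)" using row_fillings_triple[OF T ij] by blast
      then show ?thesis using Yj by auto
    next
      case False
      then have T1: "?T j (Suc c) = 1" using Yj T0 by simp
      have "Suc (Y ! i) < Suc (Suc c) \<or> Suc (Suc c) \<le> X ! i"
        using hstripD[OF hs ij jY, of "Suc (Suc c)"] False Yj len by (auto simp: boxes_def)
      then have "(i, c) \<notin> boxes Y"
      proof
        assume "Suc (Suc c) \<le> X ! i"
        then have "(i, Suc c) \<in> boxes X" using ij jY len by (simp add: boxes_def)
        then have "0 < T i (Suc c)" "(i, Suc c) \<in> boxes Y" using row_fillings_pos[OF T] sub by blast+
        then show ?thesis using le T1 by simp
      qed (simp add: boxes_def)
      then show ?thesis using T0Y T1 by simp
    qed
  qed
qed

text \<open>Rows decrease, so the entries that are at least 2 fill an initial segment of each row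
  and form the shape X. At an entry 1 the triple condition against a higher row reads: the entry in
  the same column is at least 2, or the entry one column to the left is 0. These are the two
  alternatives of \<open>hstrip\<close>. Strict growth of the first column confines an initial 1 to
  the top row, so only that row can become empty.\<close>

lemma remove_ones_row_fillings:
  assumes T: "T \<in> row_fillings Y" and pos: "\<forall>y\<in>set Y. 0 < y"
  defines "X \<equiv> map (\<lambda>i. card {c. 2 \<le> T i c}) [0..<length Y]"
  shows "(\<lambda>i c. T i c - 1) \<in> row_fillings X" "hstrip X Y" "\<And>j. 0 < j \<Longrightarrow> j < length X \<Longrightarrow> 0 < X ! j"
proof -
  have len: "length X = length Y" by (simp add: X_def)
  have box: "2 \<le> T i c \<longleftrightarrow> (i, c) \<in> boxes X" for i c
  proof (cases "i < length Y")
    case True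
    \<comment> \<open>The first position with an entry below 2; it turns out to be X ! i.\<close>
    define m where "m = (LEAST c. T i c < 2)"
    have "T i (Y ! i) = 0" using row_fillings_pos[OF T, of i "Y ! i"] by (simp add: boxes_def)
    then have m: "T i m < 2" unfolding m_def using LeastI[of "\<lambda>c. T i c < 2" "Y ! i"] by simp
    have iff: "2 \<le> T i c \<longleftrightarrow> c < m" for c
    proof
      show "c < m" if "2 \<le> T i c"
        using row_fillings_decr[OF T, of m c i] m that by (cases "m \<le> c") auto
      show "2 \<le> T i c" if "c < m"
        using not_less_Least[of c "\<lambda>c. T i c < 2"] that by (simp add: m_def)
    qed
    then have "X ! i = m" using True by (simp add: X_def)
    with iff show ?thesis using True len by (simp add: boxes_def)
  next
    case False
    then show ?thesis using row_fillings_pos[OF T, of i c] len by (simp add: boxes_def)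
  qed
  have le: "X ! i \<le> Y ! i" if "i < length Y" for i
  proof (rule ccontr)
    assume "\<not> X ! i \<le> Y ! i"
    then have "2 \<le> T i (Y ! i)" using box len that by (simp add: boxes_def)
    moreover have "T i (Y ! i) = 0" using row_fillings_pos[OF T, of i "Y ! i"] by (simp add: boxes_def)
    ultimately show False by simp
  qed
  show "(\<lambda>i c. T i c - 1) \<in> row_fillings X"
  proof (rule row_fillingsI)
    show "0 < T i c - 1 \<longleftrightarrow> (i, c) \<in> boxes X" for i c
      using box[of i c] by auto
    show "T i (Suc c) - 1 \<le> T i c - 1" for i c
      using row_fillings_decr[OF T, of c "Suc c" i] by simp
    show "T i 0 - 1 < T j 0 - 1" if "i < j" "j < length X" for i j
    proof -
      have "0 < T i 0"
        using row_fillings_pos[OF T, of i 0] pos that len by (simp add: boxes_def)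
      then show ?thesis using row_fillings_first_column[OF T, of i j] that len by simp
    qed
    show "T i c - 1 < T j (Suc c) - 1"
      if "i < j" "0 < T j (Suc c) - 1" "T i (Suc c) - 1 \<le> T j (Suc c) - 1" for i j c
      using row_fillings_triple[OF T that(1), of c] that(2,3) by linarith
  qed
  show "hstrip X Y"
    unfolding hstrip_def
  proof (intro conjI allI impI)
    show "length X = length Y" by (rule len)
    show "X ! i \<le> Y ! i" if "i < length Y" for i using le[OF that] .
    fix i j p assume *: "i < j \<and> j < length Y \<and> X ! j < p \<and> p \<le> Y ! j"
    \<comment> \<open>\<open>hstrip\<close> counts columns from 1, fillings and \<open>boxes\<close>
      count them from 0.\<close>
    have T1: "T j (p - 1) = 1"
      using * box[of j "p - 1"] row_fillings_pos[OF T, of j "p - 1"] len by (auto simp: boxes_def)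
    show "Suc (Y ! i) < p \<or> p \<le> X ! i"
    proof (cases "p = 1")
      case True
      have "T i 0 < T j 0" using row_fillings_first_column[OF T] * by blast
      moreover have "0 < T i 0"
        using row_fillings_pos[OF T, of i 0] pos * by (simp add: boxes_def)
      ultimately show ?thesis using T1 True by simp
    next
      case False
      then obtain c where p: "p = Suc (Suc c)" using * by (metis One_nat_def less_nat_zero_code not0_implies_Suc)
      show ?thesis
      proof (cases "2 \<le> T i (Suc c)")
        case True
        then show ?thesis using box[of i "Suc c"] p by (simp add: boxes_def)
      next
        case False
        then have "T i c < 1" using row_fillings_triple[OF T, of i j c] T1 p * by simp
        then have "\<not> c < Y ! i" using row_fillings_pos[OF T, of i c] * by (simp add: boxes_def)
        then show ?thesis using p by simp
      qed
    qed
  qed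
  show "0 < X ! j" if "0 < j" "j < length X" for j
  proof -
    have "0 < length Y" using that len by linarith
    then have "0 < T 0 0"
      using row_fillings_pos[OF T, of 0 0] pos nth_mem[of 0 Y] by (simp add: boxes_def)
    then have "2 \<le> T j 0" using row_fillings_first_column[OF T, of 0 j] that len by simp
    then show ?thesis using box by (simp add: boxes_def)
  qed
qed

lemma finite_hstrip_inners: "finite (hstrip_inners n ys)"
proof (rule finite_subset)
  show "hstrip_inners n ys \<subseteq> {xs. set xs \<subseteq> {..sum_list ys} \<and> length xs \<le> length ys}"
    using member_le_sum_list by (fastforce simp: hstrip_inners_def hstrip_length)
  show "finite {xs. set xs \<subseteq> {..sum_list ys} \<and> length xs \<le> length ys}"
    by (rule finite_lists_length_le) simp
qed

text \<open>The inverse adds 1 on every box of ys and hence does not depend on X, so that one map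
  serves the whole union.\<close>

lemma bij_remove_ones:
  assumes pos: "\<forall>y\<in>set ys. 0 < y"
  shows "bij_betw (\<lambda>T i c. T i c - 1) (content_fillings ys (n # as))
    (\<Union>X\<in>hstrip_inners n ys. content_fillings X as)"
proof (rule bij_betw_byWitness[where f' = "\<lambda>T i c. T i c + of_bool ((i, c) \<in> boxes ys)"])
  show "\<forall>T\<in>content_fillings ys (n # as). (\<lambda>i c. T i c - 1 + of_bool ((i, c) \<in> boxes ys)) = T"
  proof
    fix T assume "T \<in> content_fillings ys (n # as)"
    then have "T \<in> row_fillings ys" by (simp add: content_fillings_def)
    then have "0 < T i c \<longleftrightarrow> (i, c) \<in> boxes ys" for i c by (rule row_fillings_pos)
    then show "(\<lambda>i c. T i c - 1 + of_bool ((i, c) \<in> boxes ys)) = T"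
      by (intro ext) (metis (full_types) One_nat_def Suc_pred add.right_neutral add_Suc_right diff_0_eq_0 gr0I of_bool_eq(1) of_bool_eq(2))
  qed
  show "\<forall>T\<in>\<Union>X\<in>hstrip_inners n ys. content_fillings X as.
      (\<lambda>i c. T i c + of_bool ((i, c) \<in> boxes ys) - 1) = T"
  proof clarify
    fix T X assume X: "X \<in> hstrip_inners n ys" and "T \<in> content_fillings X as"
    then have T: "T \<in> row_fillings X" by (simp add: content_fillings_def)
    have "boxes X \<subseteq> boxes ys" using X boxes_mono by (simp add: hstrip_inners_def)
    then have "T i c = 0" if "(i, c) \<notin> boxes ys" for i c
      using row_fillings_pos[OF T, of i c] that by auto
    then show "(\<lambda>i c. T i c + of_bool ((i, c) \<in> boxes ys) - 1) = T"
      by (intro ext) (simp add: of_bool_def)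
  qed
  show "(\<lambda>T i c. T i c - 1) ` content_fillings ys (n # as) \<subseteq> (\<Union>X\<in>hstrip_inners n ys. content_fillings X as)"
  proof (rule image_subsetI)
    fix T assume "T \<in> content_fillings ys (n # as)"
    then have T: "T \<in> row_fillings ys"
      and c: "\<And>v. entry_count T (Suc v) = (if v < Suc (length as) then (n # as) ! v else 0)"
      by (simp_all add: content_fillings_def)
    define X where "X = map (\<lambda>i. card {c. 2 \<le> T i c}) [0..<length ys]"
    note r = remove_ones_row_fillings[OF T pos, folded X_def]
    have one: "T i c = 1 \<longleftrightarrow> (i, c) \<in> boxes ys - boxes X" for i c
      using row_fillings_pos[OF T, of i c] row_fillings_pos[OF r(1), of i c] by auto
    have n: "entry_count T 1 = n" using c[of 0] by simp
    \<comment> \<open>\<open>entry_count_1\<close> takes the size of the strip as a hypothesis, so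
      it is applied with the actual difference, which it then identifies with n. The inequality
      makes the subtraction of naturals exact.\<close>
    have "sum_list X \<le> sum_list ys"
      using card_mono[OF finite_boxes boxes_mono[OF r(2)]] by (simp add: card_boxes)
    then have s: "sum_list ys = sum_list X + (sum_list ys - sum_list X)" by simp
    have "X \<in> hstrip_inners n ys"
      using r(2,3) s entry_count_1[OF r(2) s one] n by (simp add: hstrip_inners_def)
    moreover have "entry_count (\<lambda>i c. T i c - 1) (Suc v) = entry_count T (Suc (Suc v))" for v
      unfolding entry_count_def by (rule arg_cong[where f = card]) auto
    then have "(\<lambda>i c. T i c - 1) \<in> content_fillings X as"
      using r(1) c by (simp add: content_fillings_def)
    ultimately show "(\<lambda>i c. T i c - 1) \<in> (\<Union>X\<in>hstrip_inners n ys. content_fillings X as)" by blast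
  qed
  show "(\<lambda>T i c. T i c + of_bool ((i, c) \<in> boxes ys)) ` (\<Union>X\<in>hstrip_inners n ys. content_fillings X as)
      \<subseteq> content_fillings ys (n # as)"
  proof clarify
    fix T X assume X: "X \<in> hstrip_inners n ys" and T': "T \<in> content_fillings X as"
    then have T: "T \<in> row_fillings X" by (simp add: content_fillings_def)
    have hs: "hstrip X ys" "sum_list ys = sum_list X + n" using X by (simp_all add: hstrip_inners_def)
    let ?T = "\<lambda>i c. T i c + of_bool ((i, c) \<in> boxes ys)"
    have one: "?T i c = 1 \<longleftrightarrow> (i, c) \<in> boxes ys - boxes X" for i c
      using row_fillings_pos[OF T, of i c] boxes_mono[OF hs(1)] by auto
    have more: "?T i c = Suc (Suc v) \<longleftrightarrow> T i c = Suc v" for i c v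
      using row_fillings_pos[OF T, of i c] boxes_mono[OF hs(1)] by auto
    have "entry_count ?T (Suc v) = (if v < length (n # as) then (n # as) ! v else 0)" for v
    proof (cases v)
      case 0
      then show ?thesis using entry_count_1[OF hs one] by simp
    next
      case (Suc w)
      have "entry_count ?T (Suc (Suc w)) = entry_count T (Suc w)"
        unfolding entry_count_def more ..
      then show ?thesis using T' Suc by (simp add: content_fillings_def)
    qed
    then show "?T \<in> content_fillings ys (n # as)"
      using add_ones_row_fillings[OF T hs(1) pos] by (simp add: content_fillings_def)
  qed
qed

lemma card_content_fillings_Cons:
  assumes "\<forall>y\<in>set ys. 0 < y"
  shows "card (content_fillings ys (n # as)) = (\<Sum>X\<in>hstrip_inners n ys. card (content_fillings X as))"
proof -
  have "card (content_fillings ys (n # as)) = card (\<Union>X\<in>hstrip_inners n ys. content_fillings X as)"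
    using bij_remove_ones[OF assms] by (rule bij_betw_same_card)
  also have "\<dots> = (\<Sum>X\<in>hstrip_inners n ys. card (content_fillings X as))"
  proof (rule card_UN_disjoint[OF finite_hstrip_inners])
    show "\<forall>X\<in>hstrip_inners n ys. finite (content_fillings X as)"
      by (simp add: finite_content_fillings)
    show "\<forall>X\<in>hstrip_inners n ys. \<forall>Z\<in>hstrip_inners n ys. X \<noteq> Z \<longrightarrow>
        content_fillings X as \<inter> content_fillings Z as = {}"
    proof (intro ballI impI)
      fix X Z assume "X \<in> hstrip_inners n ys" "Z \<in> hstrip_inners n ys" and XZ: "X \<noteq> Z"
      then have "length X = length Z"
        using hstrip_length[of X ys] hstrip_length[of Z ys] by (simp add: hstrip_inners_def)
      then show "content_fillings X as \<inter> content_fillings Z as = {}"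
        using XZ row_fillings_length_eq by (auto simp: content_fillings_def)
    qed
  qed
  finally show ?thesis .
qed

text \<open>Inner shapes X and compositions \<rho> correspond by dropping a leading 0; the number of
  rows of \<beta> decides whether it must be put back. With \<beta> fixed and \<rho> varying, this
  is the transpose of the Pieri rule.\<close>

lemma card_content_fillings_LH:
  "card (content_fillings (parts \<beta>) (n # as)) = (\<Sum>\<rho> | LH n \<rho> \<beta>. card (content_fillings (parts \<rho>) as))"
proof -
  define strip where "strip X = Composition (if X \<noteq> [] \<and> hd X = 0 then tl X else X)" for X
  define extend where "extend \<rho> = (if length (parts \<rho>) = length (parts \<beta>) then parts \<rho> else 0 # parts \<rho>)" for \<rho>
  have pos: "\<forall>y\<in>set (parts \<gamma>). 0 < y" for \<gamma> using parts[of \<gamma>] by simp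
  have strip: "X = parts (strip X) \<or> X = 0 # parts (strip X)" if X: "X \<in> hstrip_inners n (parts \<beta>)" for X
  proof -
    have p: "0 < X ! j" if "0 < j" "j < length X" for j
      using X that by (simp add: hstrip_inners_def)
    show ?thesis
    proof (cases X)
      case Nil
      then show ?thesis by (simp add: strip_def Composition_inverse)
    next
      case (Cons x xs)
      have xs: "\<forall>y\<in>set xs. 0 < y"
        using p Cons by (metis Suc_less_eq in_set_conv_nth length_Cons nth_Cons_Suc zero_less_Suc)
      then show ?thesis using Cons
        by (cases "x = 0") (simp_all add: strip_def Composition_inverse)
    qed
  qed
  have strip_pos: "strip (parts \<rho>) = \<rho>" for \<rho>
  proof -
    have "parts \<rho> \<noteq> [] \<Longrightarrow> hd (parts \<rho>) \<noteq> 0" using pos[of \<rho>] by (cases "parts \<rho>") auto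
    then show ?thesis by (auto simp: strip_def parts_inverse)
  qed
  have ext: "extend \<rho> \<in> hstrip_inners n (parts \<beta>)" if LH: "LH n \<rho> \<beta>" for \<rho>
  proof -
    obtain X where X: "X \<in> {parts \<rho>, 0 # parts \<rho>}" "hstrip X (parts \<beta>)" "sum_list (parts \<beta>) = sum_list X + n"
      using LH LH_iff by blast
    then have "X = extend \<rho>"
      using hstrip_length[OF X(2)] unfolding extend_def by auto
    moreover have "0 < X ! j" if "0 < j" "j < length X" for j
      using X(1) parts_pos[of j \<rho>] parts_pos[of "j - 1" \<rho>] that by (auto simp: nth_Cons')
    ultimately show ?thesis using X by (simp add: hstrip_inners_def)
  qed
  have strip_ext: "strip (extend \<rho>) = \<rho>" for \<rho>
  proof -
    have "strip (0 # parts \<rho>) = \<rho>" by (simp add: strip_def parts_inverse)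
    then show ?thesis using strip_pos[of \<rho>] by (simp add: extend_def)
  qed
  have ext_strip: "extend (strip X) = X" if X: "X \<in> hstrip_inners n (parts \<beta>)" for X
  proof -
    have "length X = length (parts \<beta>)" using X hstrip_length by (simp add: hstrip_inners_def)
    then show ?thesis using strip[OF X] unfolding extend_def by (metis Suc_neq_Zero length_Cons n_not_Suc_n)
  qed
  have "(\<Sum>X\<in>hstrip_inners n (parts \<beta>). card (content_fillings X as)) =
      (\<Sum>\<rho> | LH n \<rho> \<beta>. card (content_fillings (parts \<rho>) as))"
  proof (rule sum.reindex_bij_witness[where i = extend and j = strip])
    fix X assume X: "X \<in> hstrip_inners n (parts \<beta>)"
    show "extend (strip X) = X" by (rule ext_strip[OF X])
    have "X \<in> {parts (strip X), 0 # parts (strip X)}" using strip[OF X] by blast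
    then have "LH n (strip X) \<beta>" unfolding LH_iff using X by (intro bexI[of _ X]) (simp_all add: hstrip_inners_def)
    then show "strip X \<in> {\<rho>. LH n \<rho> \<beta>}" by simp
    show "card (content_fillings (parts (strip X)) as) = card (content_fillings X as)"
      using strip[OF X] card_content_fillings_zero_row[OF pos] by metis
  qed (use ext strip_ext in auto)
  then show ?thesis using card_content_fillings_Cons[OF pos] by simp
qed

section \<open>The Pieri rule for rows\<close>

lemma poly_mapping_sum_single: "h = (\<Sum>k\<in>Poly_Mapping.keys h. Poly_Mapping.single k (Poly_Mapping.lookup h k))"
  by (rule poly_mapping_eqI) (simp add: lookup_sum lookup_single when_def in_keys_iff)

lemma poly_mapping_add_induct [case_names zero single add]:
  assumes "P 0" "\<And>k c. P (Poly_Mapping.single k c)" "\<And>g h. P g \<Longrightarrow> P h \<Longrightarrow> P (g + h)"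
  shows "P (h :: 'k \<Rightarrow>\<^sub>0 'a::comm_monoid_add)"
proof -
  have "P (\<Sum>k\<in>A. Poly_Mapping.single k (Poly_Mapping.lookup h k))" if "finite A" for A
    using that by (induction A rule: finite_induct) (simp_all add: assms)
  then show ?thesis using poly_mapping_sum_single[of h] finite_keys by metis
qed

lemma single_sum: "Poly_Mapping.single k (sum f A) = (\<Sum>x\<in>A. Poly_Mapping.single k (f x))"
  by (induction A rule: infinite_finite_induct) (simp_all add: single_add)

lemma sum_keys_superset:
  assumes "finite A" "Poly_Mapping.keys h \<subseteq> A" "\<And>k. f k 0 = 0"
  shows "(\<Sum>k\<in>Poly_Mapping.keys h. f k (Poly_Mapping.lookup h k)) = (\<Sum>k\<in>A. f k (Poly_Mapping.lookup h k))"
  by (rule sum.mono_neutral_left) (use assms in \<open>auto simp: in_keys_iff\<close>)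

lemma sum_keys_add:
  assumes "\<And>k. f k 0 = 0" "\<And>k x y. f k (x + y) = f k x + f k y"
  shows "(\<Sum>k\<in>Poly_Mapping.keys (g + h). f k (Poly_Mapping.lookup (g + h) k)) =
    (\<Sum>k\<in>Poly_Mapping.keys g. f k (Poly_Mapping.lookup g k)) + (\<Sum>k\<in>Poly_Mapping.keys h. f k (Poly_Mapping.lookup h k))"
proof -
  let ?A = "Poly_Mapping.keys g \<union> Poly_Mapping.keys h"
  have "Poly_Mapping.keys (g + h) \<subseteq> ?A" by (rule Poly_Mapping.keys_add)
  then show ?thesis
    by (simp add: sum_keys_superset[of ?A "g + h" f] sum_keys_superset[of ?A g f] sum_keys_superset[of ?A h f]
        assms(1)) (simp add: assms(2) lookup_add sum.distrib)
qed

lemma pairing_add: "pairing (g + h) f = pairing g f + pairing h f"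
  unfolding pairing_def by (rule sum_keys_add) (simp_all add: distrib_right)

lemma pairing_single: "pairing (Poly_Mapping.single \<alpha> c) f = c * f (initial_monomial \<alpha>)"
  by (cases "c = 0") (simp_all add: pairing_def)

lemma pairing_0 [simp]: "pairing 0 f = 0"
  by (simp add: pairing_def)

lemma pairing_sum: "pairing (sum g A) f = (\<Sum>x\<in>A. pairing (g x) f)"
  by (induction A rule: infinite_finite_induct) (simp_all add: pairing_add)

lemma pairing_diff: "pairing (g - h) f = pairing g f - pairing h (f :: 'a::ring_1 series)"
  using pairing_add[of "g - h" h f] by simp

lemma pairing_scale: "pairing (Poly_Mapping.single 0 c * h) f = c * pairing h f"
  by (induction h rule: poly_mapping_add_induct)
    (simp_all add: pairing_add pairing_single mult_single distrib_left mult.assoc)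

lemma single_0_commute:
  fixes c :: "'a::comm_ring_1" and h :: "'k::monoid_add \<Rightarrow>\<^sub>0 'a"
  shows "h * Poly_Mapping.single 0 c = Poly_Mapping.single 0 c * h"
  by (induction h rule: poly_mapping_add_induct)
    (simp_all add: mult_single distrib_left distrib_right mult.commute)

lemma parts_row_comp_plus: "0 < n \<Longrightarrow> parts (row_comp n + \<alpha>) = n # parts \<alpha>"
  by (simp add: plus_composition.rep_eq row_comp.rep_eq)

lemma row_comp_0 [simp]: "row_comp 0 = 0"
  by (simp add: row_comp_def zero_composition_def)

lemma column_comp_0 [simp]: "column_comp 0 = 0"
  by (simp add: column_comp_def zero_composition_def)

lemma parts_0 [simp]: "parts 0 = []"
  by (rule zero_composition.rep_eq)

lemma LH_size: "LH n \<alpha> \<beta> \<Longrightarrow> sum_list (parts \<beta>) = sum_list (parts \<alpha>) + n"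
  by (auto simp: LH_def left_adds_size)

lemma LV_size: "LV n \<alpha> \<beta> \<Longrightarrow> sum_list (parts \<beta>) = sum_list (parts \<alpha>) + n"
  by (auto simp: LV_def left_adds_size)

lemma finite_strips [simp]:
  "finite {\<beta>. LH n \<alpha> \<beta>}" "finite {\<alpha>. LH n \<alpha> \<beta>}" "finite {\<beta>. LV n \<alpha> \<beta>}" "finite {\<alpha>. LV n \<alpha> \<beta>}"
proof -
  have *: "finite A" if "\<And>\<gamma>. \<gamma> \<in> A \<Longrightarrow> sum_list (parts \<gamma>) \<le> m" for A and m :: nat
    using that by (intro finite_subset[OF _ finite_composition_size[of m]]) auto
  show "finite {\<beta>. LH n \<alpha> \<beta>}" "finite {\<beta>. LV n \<alpha> \<beta>}"
    by (auto intro!: *[of _ "sum_list (parts \<alpha>) + n"] dest: LH_size LV_size)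
  show "finite {\<alpha>. LH n \<alpha> \<beta>}" "finite {\<alpha>. LV n \<alpha> \<beta>}"
    by (auto intro!: *[of _ "sum_list (parts \<beta>)"] dest: LH_size LV_size)
qed

text \<open>For h = \<open>H \<alpha>\<close> the left side counts fillings with content (n,
  \<alpha>), and deleting the entries 1 leaves content \<alpha>; the general case follows by
  linearity. The case n = 0 stands apart because \<open>row_comp 0\<close> contributes no part to
  the content.\<close>

lemma pairing_H_row_mult:
  fixes h :: "'a::comm_ring_1 nsym"
  shows "pairing (H (row_comp n) * h) (qsym_schur \<beta>) = (\<Sum>\<rho> | LH n \<rho> \<beta>. pairing h (qsym_schur \<rho>))"
proof (cases "n = 0")
  case True
  then show ?thesis by (simp add: LH_0)
next
  case False
  show ?thesis
  proof (induction h rule: poly_mapping_add_induct)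
    case (single \<alpha> c)
    show ?case using False
      by (simp add: H_def mult_single pairing_single qsym_schur_initial_monomial parts_row_comp_plus
          card_content_fillings_LH sum_distrib_left)
  next
    case (add g h)
    then show ?case by (simp add: distrib_left pairing_add sum.distrib)
  qed simp
qed

lemma pairing_1: "pairing (1 :: 'a::comm_ring_1 nsym) (qsym_schur \<beta>) = (if \<beta> = 0 then 1 else 0)"
proof (cases "\<beta> = 0")
  case True
  have "content_fillings [] [] = {\<lambda>_ _. 0}"
    by (auto simp: content_fillings_def row_fillings_def entry_count_def fun_eq_iff)
  then show ?thesis using True pairing_H[of 0 "qsym_schur \<beta>"] by (simp add: qsym_schur_initial_monomial)
next
  case False
  then obtain y ys where y: "parts \<beta> = y # ys" "0 < y"
    using parts[of \<beta>] by (cases "parts \<beta>") (auto simp: parts_inverse zero_composition_def dest: arg_cong[of _ _ Composition])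
  have "content_fillings (parts \<beta>) [] = {}"
  proof (rule equals0I)
    fix T assume T: "T \<in> content_fillings (parts \<beta>) []"
    then have r: "T \<in> row_fillings (parts \<beta>)" by (simp add: content_fillings_def)
    have "0 < T 0 0" using row_fillings_pos[OF r, of 0 0] y by (simp add: boxes_def)
    then obtain v where v: "T 0 0 = Suc v" using gr0_conv_Suc by blast
    have "{(i, c). T i c = Suc v} \<subseteq> boxes (parts \<beta>)"
    proof (clarify)
      fix i c assume "T i c = Suc v"
      then show "(i, c) \<in> boxes (parts \<beta>)" using row_fillings_pos[OF r, of i c] by simp
    qed
    then have "finite {(i, c). T i c = Suc v}" using finite_subset finite_boxes by blast
    moreover have "entry_count T (Suc v) = 0" using T by (simp add: content_fillings_def)
    ultimately have "{(i, c). T i c = Suc v} = {}" by (simp add: entry_count_def)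
    then show False using v by blast
  qed
  then show ?thesis using False pairing_H[of 0 "qsym_schur \<beta>"] by (simp add: qsym_schur_initial_monomial)
qed

section \<open>The dual basis obtained from the Pieri rule\<close>

lemma LH_row_comp_plus: "LH n \<alpha> (row_comp n + \<alpha>)"
proof (cases "n = 0")
  case False
  then show ?thesis unfolding LH_iff
    by (intro bexI[of _ "0 # parts \<alpha>"]) (simp_all add: parts_row_comp_plus hstrip_add_row)
qed (simp add: LH_0)

text \<open>This is the triangularity that makes the Pieri rule solvable. If a new first row
  appears, the remaining rows dominate \<alpha> part by part, so at most n boxes are left for it,
  and exactly n only if nothing else has grown.\<close>

lemma LH_measure:
  assumes "LH n \<alpha> \<rho>" "0 < n" "\<rho> \<noteq> row_comp n + \<alpha>"
  shows "length (parts \<rho>) < Suc (length (parts \<alpha>)) \<or>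
    length (parts \<rho>) = Suc (length (parts \<alpha>)) \<and> hd (parts \<rho>) < n"
proof -
  obtain X where X: "X \<in> {parts \<alpha>, 0 # parts \<alpha>}" "hstrip X (parts \<rho>)" "sum_list (parts \<rho>) = sum_list X + n"
    using assms(1) LH_iff by blast
  note len = hstrip_length[OF X(2)]
  show ?thesis
  proof (cases "X = parts \<alpha>")
    case True
    then show ?thesis using len by simp
  next
    case False
    then have X0: "X = 0 # parts \<alpha>" using X by simp
    then obtain y ys where y: "parts \<rho> = y # ys" using len by (cases "parts \<rho>") auto
    have le: "parts \<alpha> ! i \<le> ys ! i" if "i < length ys" for i
      using hstrip_le[OF X(2), of "Suc i"] X0 y that by simp
    have leny: "length ys = length (parts \<alpha>)" using len X0 y by simp
    have sum_le: "sum_list (parts \<alpha>) \<le> sum_list ys"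
      unfolding sum_list_sum_nth leny by (intro sum_mono) (use le leny in auto)
    have "y < n"
    proof (rule ccontr)
      assume "\<not> y < n"
      then have yn: "y = n" "sum_list ys = sum_list (parts \<alpha>)" using X(3) X0 y sum_le by auto
      have "parts \<alpha> ! i = ys ! i" if i: "i < length ys" for i
      proof (rule ccontr)
        assume "parts \<alpha> ! i \<noteq> ys ! i"
        then have "sum_list (parts \<alpha>) < sum_list ys"
          unfolding sum_list_sum_nth leny
          by (intro sum_strict_mono_ex1) (use le leny i in \<open>auto intro!: bexI[of _ i] simp: le_neq_implies_less\<close>)
        then show False using yn by simp
      qed
      then have "parts \<rho> = parts (row_comp n + \<alpha>)"
        using y yn leny assms(2) by (simp add: parts_row_comp_plus nth_equalityI)
      then show False using assms(3) by (simp add: parts_inject)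
    qed
    then show ?thesis using y leny by simp
  qed
qed

lemma composition_cases:
  obtains (zero) "\<alpha> = 0" | (plus) n \<beta> where "0 < n" "\<alpha> = row_comp n + \<beta>"
proof (cases "parts \<alpha>")
  case Nil
  then have "\<alpha> = 0" by (simp flip: parts_inject)
  then show ?thesis by (rule zero)
next
  case (Cons n ns)
  then have pos: "\<forall>x\<in>set (n # ns). 0 < x" using parts[of \<alpha>] by simp
  then have "parts (Composition ns) = ns" by (simp add: Composition_inverse)
  then have "\<alpha> = row_comp n + Composition ns" "0 < n"
    using Cons pos by (simp_all flip: parts_inject add: parts_row_comp_plus)
  then show ?thesis using plus by blast
qed

lemma composition_induct [case_names zero plus]:
  assumes "P 0" "\<And>n \<beta>. 0 < n \<Longrightarrow> P \<beta> \<Longrightarrow> P (row_comp n + \<beta>)"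
  shows "P \<alpha>"
proof (induction "length (parts \<alpha>)" arbitrary: \<alpha>)
  case 0
  then have "\<alpha> = 0" by (simp flip: parts_inject)
  then show ?case using assms(1) by simp
next
  case (Suc m)
  then show ?case
    by (cases \<alpha> rule: composition_cases) (use assms(2) Suc in \<open>auto simp: parts_row_comp_plus\<close>)
qed

text \<open>The Pieri rule for \<open>H\<^sub>n s\<^sub>\<beta>\<close>, solved for its leading term: among the \<open>\<rho>\<close> with \<open>\<beta> \<rightarrow>\<^sup>L\<^sup>H \<rho>\<close>, the
  composition \<open>(n, \<beta>)\<close> alone has maximal length and, among those, maximal first part.\<close>

function schur_rec :: "composition \<Rightarrow> 'a::comm_ring_1 nsym" where
  "schur_rec \<alpha> = (if \<alpha> = 0 then 1 else
     H (row_comp (hd (parts \<alpha>))) * schur_rec (Composition (tl (parts \<alpha>))) -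
     (\<Sum>\<rho> | LH (hd (parts \<alpha>)) (Composition (tl (parts \<alpha>))) \<rho> \<and> \<rho> \<noteq> \<alpha>. schur_rec \<rho>))"
  by auto

termination
proof (relation "measures [\<lambda>\<alpha>. length (parts \<alpha>), \<lambda>\<alpha>. hd (parts \<alpha>)]", goal_cases)
  case (2 \<alpha>)
  then show ?case
  proof (cases \<alpha> rule: composition_cases)
    case (plus n \<beta>)
    then show ?thesis by (simp add: parts_row_comp_plus parts_inverse)
  qed simp
next
  case (3 \<alpha> \<rho>)
  then show ?case
  proof (cases \<alpha> rule: composition_cases)
    case (plus n \<beta>)
    then show ?thesis using 3 LH_measure[of n \<beta> \<rho>] by (simp add: parts_row_comp_plus parts_inverse)
  qed simp
qed simp

declare schur_rec.simps [simp del]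

lemma schur_rec_0 [simp]: "schur_rec 0 = 1"
  by (simp add: schur_rec.simps)

lemma H_row_mult_schur_rec:
  "H (row_comp n) * schur_rec \<beta> = (\<Sum>\<rho> | LH n \<beta> \<rho>. schur_rec \<rho> :: 'a::comm_ring_1 nsym)"
proof (cases "n = 0")
  case False
  let ?\<alpha> = "row_comp n + \<beta>"
  have "?\<alpha> \<noteq> 0" using False parts_row_comp_plus[of n \<beta>] by auto
  then have "schur_rec ?\<alpha> = H (row_comp n) * schur_rec \<beta> - (\<Sum>\<rho> | LH n \<beta> \<rho> \<and> \<rho> \<noteq> ?\<alpha>. schur_rec \<rho> :: 'a nsym)"
    using False by (subst schur_rec.simps) (simp add: parts_row_comp_plus parts_inverse)
  moreover have "(\<Sum>\<rho> | LH n \<beta> \<rho>. schur_rec \<rho>) = schur_rec ?\<alpha> + (\<Sum>\<rho>\<in>{\<rho>. LH n \<beta> \<rho>} - {?\<alpha>}. schur_rec \<rho> :: 'a nsym)"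
    by (rule sum.remove) (simp_all add: LH_row_comp_plus)
  moreover have "{\<rho>. LH n \<beta> \<rho>} - {?\<alpha>} = {\<rho>. LH n \<beta> \<rho> \<and> \<rho> \<noteq> ?\<alpha>}" by auto
  ultimately show ?thesis by simp
qed (simp add: LH_0)

text \<open>Pairing the recursion with \<open>qsym_schur \<beta>\<close> and moving
  \<open>H_n\<close> to the other side turns its product term into the indicator of
  \<open>LH n \<gamma> \<beta>\<close>. By induction the subtracted terms remove all \<rho> other
  than \<alpha>. The induction uses the termination order of \<open>schur_rec\<close>.\<close>

lemma pairing_schur_rec:
  "pairing (schur_rec \<alpha> :: 'a::comm_ring_1 nsym) (qsym_schur \<beta>) = (if \<alpha> = \<beta> then 1 else 0)"
proof (induction "(length (parts \<alpha>), hd (parts \<alpha>))" arbitrary: \<alpha> \<beta> rule: wf_induct_rule[OF wf_lex_prod[OF wf_less_than wf_less_than]])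
  case (1 \<alpha>)
  show ?case
  proof (cases \<alpha> rule: composition_cases)
    case zero
    then show ?thesis by (auto simp: pairing_1)
  next
    case (plus n \<gamma>)
    have \<gamma>: "pairing (schur_rec \<gamma> :: 'a nsym) (qsym_schur \<beta>) = (if \<gamma> = \<beta> then 1 else 0)" for \<beta>
      using plus by (intro 1) (simp add: parts_row_comp_plus)
    have \<rho>: "pairing (schur_rec \<rho> :: 'a nsym) (qsym_schur \<beta>) = (if \<rho> = \<beta> then 1 else 0)"
      if "\<rho> \<in> {\<rho>. LH n \<gamma> \<rho>} - {\<alpha>}" for \<rho> \<beta>
      using plus LH_measure[of n \<gamma> \<rho>] that by (intro 1) (auto simp: parts_row_comp_plus)
    let ?S = "{\<rho>. LH n \<gamma> \<rho>} - {\<alpha>}"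
    have "(\<Sum>\<rho> | LH n \<gamma> \<rho>. schur_rec \<rho>) = schur_rec \<alpha> + (\<Sum>\<rho>\<in>?S. schur_rec \<rho> :: 'a nsym)"
      using plus by (intro sum.remove) (simp_all add: LH_row_comp_plus)
    then have "schur_rec \<alpha> = H (row_comp n) * schur_rec \<gamma> - (\<Sum>\<rho>\<in>?S. schur_rec \<rho> :: 'a nsym)"
      by (simp add: H_row_mult_schur_rec)
    then have "pairing (schur_rec \<alpha> :: 'a nsym) (qsym_schur \<beta>) =
        (\<Sum>\<rho> | LH n \<rho> \<beta>. if \<gamma> = \<rho> then 1 else 0) - (\<Sum>\<rho>\<in>?S. if \<rho> = \<beta> then 1 else 0)"
      by (simp add: pairing_diff pairing_sum pairing_H_row_mult \<gamma> \<rho>)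
    also have "\<dots> = (if \<alpha> = \<beta> then 1 else 0)"
      using plus LH_row_comp_plus[of n \<gamma>] by auto
    finally show ?thesis .
  qed
qed

text \<open>Duality alone does not show that the candidates span; this does. The coefficients of
  \<open>H_\<alpha>\<close> satisfy the recursion of the filling counts, which matches the Pieri
  rule applied to \<open>H_n\<close> times the expansion of \<open>H_\<gamma>\<close>.\<close>

lemma H_eq_sum_schur_rec_same_size:
  "H \<alpha> = (\<Sum>\<beta> | sum_list (parts \<beta>) = sum_list (parts \<alpha>).
     Poly_Mapping.single 0 (qsym_schur \<beta> (initial_monomial \<alpha>)) * (schur_rec \<beta> :: 'a::comm_ring_1 nsym))"
proof (induction \<alpha> rule: composition_induct)
  case zero
  have "qsym_schur \<beta> (initial_monomial 0) = (if \<beta> = 0 then 1 else 0 :: 'a)" for \<beta>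
    using pairing_1[where 'a = 'a, of \<beta>] pairing_H[of 0 "qsym_schur \<beta> :: 'a series"] by simp
  moreover have "{\<beta>. sum_list (parts \<beta>) = sum_list (parts 0)} = {0}"
  proof -
    have "\<beta> = 0" if "sum_list (parts \<beta>) = 0" for \<beta>
      using that by (cases \<beta> rule: composition_cases) (auto simp: parts_row_comp_plus)
    then show ?thesis by auto
  qed
  ultimately show ?case by simp
next
  case (plus n \<gamma>)
  let ?k = "\<lambda>\<beta> \<alpha>. Poly_Mapping.single 0 (qsym_schur \<beta> (initial_monomial \<alpha>) :: 'a)"
  let ?B = "\<lambda>\<alpha>. {\<beta>. sum_list (parts \<beta>) = sum_list (parts \<alpha>)}"
  let ?\<alpha> = "row_comp n + \<gamma>"
  have size: "sum_list (parts ?\<alpha>) = n + sum_list (parts \<gamma>)"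
    using plus by (simp add: parts_row_comp_plus)
  have fin: "finite (?B \<alpha>)" for \<alpha>
    by (rule finite_subset[OF _ finite_composition_size[of "sum_list (parts \<alpha>)"]]) auto
  have k: "qsym_schur \<beta> (initial_monomial ?\<alpha>) = (\<Sum>\<rho> | LH n \<rho> \<beta>. qsym_schur \<rho> (initial_monomial \<gamma>) :: 'a)" for \<beta>
    using plus by (simp add: qsym_schur_initial_monomial parts_row_comp_plus card_content_fillings_LH)
  have "H ?\<alpha> = H (row_comp n) * (\<Sum>\<rho>\<in>?B \<gamma>. ?k \<rho> \<gamma> * schur_rec \<rho>)"
    by (simp only: H_plus plus.IH[symmetric])
  also have "\<dots> = (\<Sum>\<rho>\<in>?B \<gamma>. \<Sum>\<beta> | LH n \<rho> \<beta>. ?k \<rho> \<gamma> * schur_rec \<beta>)"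
    by (simp add: sum_distrib_left mult.assoc[symmetric] single_0_commute[of "H (row_comp n)"])
      (simp add: mult.assoc H_row_mult_schur_rec sum_distrib_left)
  \<comment> \<open>A strip determines the size of its outer shape, so \<beta> may be confined to a
    finite set independent of \<rho>; then the sums can be exchanged.\<close>
  also have "\<dots> = (\<Sum>\<rho>\<in>?B \<gamma>. \<Sum>\<beta> | \<beta> \<in> ?B ?\<alpha> \<and> LH n \<rho> \<beta>. ?k \<rho> \<gamma> * schur_rec \<beta>)"
    by (intro sum.cong) (auto simp: size dest: LH_size)
  also have "\<dots> = (\<Sum>\<beta>\<in>?B ?\<alpha>. \<Sum>\<rho> | \<rho> \<in> ?B \<gamma> \<and> LH n \<rho> \<beta>. ?k \<rho> \<gamma> * schur_rec \<beta>)"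
    by (rule sum.swap_restrict[OF fin fin])
  also have "\<dots> = (\<Sum>\<beta>\<in>?B ?\<alpha>. \<Sum>\<rho> | LH n \<rho> \<beta>. ?k \<rho> \<gamma> * schur_rec \<beta>)"
    by (intro sum.cong) (auto simp: size dest: LH_size)
  also have "\<dots> = (\<Sum>\<beta>\<in>?B ?\<alpha>. ?k \<beta> ?\<alpha> * schur_rec \<beta>)"
    unfolding k by (intro sum.cong refl) (simp add: sum_distrib_right single_sum)
  finally show ?case .
qed

text \<open>Coefficients for other sizes vanish, as pairing the expansion shows. The freedom in A
  lets one index set serve several \<open>H_\<alpha>\<close> at once.\<close>

lemma H_eq_sum_schur_rec:
  assumes "finite A" "{\<beta>. sum_list (parts \<beta>) = sum_list (parts \<alpha>)} \<subseteq> A"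
  shows "H \<alpha> = (\<Sum>\<beta>\<in>A. Poly_Mapping.single 0 (qsym_schur \<beta> (initial_monomial \<alpha>)) * (schur_rec \<beta> :: 'a::comm_ring_1 nsym))"
proof -
  have "qsym_schur \<beta> (initial_monomial \<alpha>) = (0 :: 'a)" if "sum_list (parts \<beta>) \<noteq> sum_list (parts \<alpha>)" for \<beta>
  proof -
    have "qsym_schur \<beta> (initial_monomial \<alpha>) = pairing (H \<alpha> :: 'a nsym) (qsym_schur \<beta>)"
      by (simp add: pairing_H)
    also have "\<dots> = 0"
      using that by (subst H_eq_sum_schur_rec_same_size)
        (auto simp: pairing_sum pairing_scale pairing_schur_rec intro!: sum.neutral)
    finally show ?thesis .
  qed
  then show ?thesis
    by (subst H_eq_sum_schur_rec_same_size) (rule sum.mono_neutral_left, use assms in auto)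
qed

lemma schur_rec_expansion:
  obtains A where "finite A"
    "(h :: 'a::comm_ring_1 nsym) = (\<Sum>\<beta>\<in>A. Poly_Mapping.single 0 (pairing h (qsym_schur \<beta>)) * schur_rec \<beta>)"
proof -
  define A where "A = (\<Union>\<alpha>\<in>Poly_Mapping.keys h. {\<beta>. sum_list (parts \<beta>) = sum_list (parts \<alpha>)})"
  have fin: "finite A"
    unfolding A_def by (intro finite_UN_I finite_keys finite_subset[OF _ finite_composition_size]) auto
  have "h = (\<Sum>\<alpha>\<in>Poly_Mapping.keys h. Poly_Mapping.single 0 (Poly_Mapping.lookup h \<alpha>) * H \<alpha>)"
    by (subst poly_mapping_sum_single) (simp add: H_def mult_single)
  also have "\<dots> = (\<Sum>\<alpha>\<in>Poly_Mapping.keys h. \<Sum>\<beta>\<in>A. Poly_Mapping.single 0 (Poly_Mapping.lookup h \<alpha>) *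
      (Poly_Mapping.single 0 (qsym_schur \<beta> (initial_monomial \<alpha>)) * schur_rec \<beta>))"
  proof (intro sum.cong refl)
    fix \<alpha> assume "\<alpha> \<in> Poly_Mapping.keys h"
    then have "H \<alpha> = (\<Sum>\<beta>\<in>A. Poly_Mapping.single 0 (qsym_schur \<beta> (initial_monomial \<alpha>)) * (schur_rec \<beta> :: 'a nsym))"
      by (intro H_eq_sum_schur_rec fin) (auto simp: A_def)
    then show "Poly_Mapping.single 0 (Poly_Mapping.lookup h \<alpha>) * H \<alpha> = (\<Sum>\<beta>\<in>A. Poly_Mapping.single 0 (Poly_Mapping.lookup h \<alpha>) *
        (Poly_Mapping.single 0 (qsym_schur \<beta> (initial_monomial \<alpha>)) * schur_rec \<beta>))"
      by (simp add: sum_distrib_left)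
  qed
  also have "\<dots> = (\<Sum>\<beta>\<in>A. Poly_Mapping.single 0 (pairing h (qsym_schur \<beta>)) * schur_rec \<beta>)"
    by (subst sum.swap) (simp add: pairing_def single_sum sum_distrib_right mult.assoc[symmetric] mult_single)
  finally show thesis by (rule that[OF fin])
qed

lemma pairing_nondegenerate:
  assumes "\<And>\<beta>. pairing h (qsym_schur \<beta>) = 0"
  shows "h = (0 :: 'a::comm_ring_1 nsym)"
  using schur_rec_expansion[of h] assms by (metis (no_types, lifting) mult_zero_left single_zero sum.neutral)

lemma nc_schur_eq_schur_rec: "nc_schur \<alpha> = (schur_rec \<alpha> :: 'a::field_char_0 nsym)"
  unfolding nc_schur_def
proof (rule the_equality)
  fix s :: "'a nsym" assume s: "\<forall>\<beta>. pairing s (qsym_schur \<beta>) = (if \<alpha> = \<beta> then 1 else 0)"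
  have "s - schur_rec \<alpha> = 0"
    by (rule pairing_nondegenerate) (simp add: pairing_diff s pairing_schur_rec)
  then show "s = schur_rec \<alpha>" by simp
qed (simp add: pairing_schur_rec)

lemma pairing_nc_schur:
  "pairing (nc_schur \<alpha> :: 'a::field_char_0 nsym) (qsym_schur \<beta>) = (if \<alpha> = \<beta> then 1 else 0)"
  by (simp add: nc_schur_eq_schur_rec pairing_schur_rec)

lemma nc_schur_0: "nc_schur 0 = (1 :: 'a::field_char_0 nsym)"
  by (simp add: nc_schur_eq_schur_rec)

lemma H_row_mult_nc_schur:
  "H (row_comp n) * nc_schur \<alpha> = (\<Sum>\<rho> | LH n \<alpha> \<rho>. nc_schur \<rho> :: 'a::field_char_0 nsym)"
  by (simp add: nc_schur_eq_schur_rec H_row_mult_schur_rec)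

lemma nc_schur_induct [case_names zero single add]:
  assumes "P 0" "\<And>c \<beta>. P (Poly_Mapping.single 0 c * nc_schur \<beta>)" "\<And>g h. P g \<Longrightarrow> P h \<Longrightarrow> P (g + h)"
  shows "P (h :: 'a::field_char_0 nsym)"
proof -
  obtain A where A: "finite A"
    "h = (\<Sum>\<beta>\<in>A. Poly_Mapping.single 0 (pairing h (qsym_schur \<beta>)) * nc_schur \<beta>)"
    using schur_rec_expansion unfolding nc_schur_eq_schur_rec by blast
  have "P (\<Sum>\<beta>\<in>A. Poly_Mapping.single 0 (pairing h (qsym_schur \<beta>)) * nc_schur \<beta>)"
    using A(1) by (induction A rule: finite_induct) (simp_all add: assms)
  then show ?thesis using A(2) by simp
qed

section \<open>The Pieri rule for columns\<close>

text \<open>The number of boxes in column p of the diagram, counted from 1.\<close>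

definition parts_ge :: "nat \<Rightarrow> nat list \<Rightarrow> nat" where
  "parts_ge p xs = size (filter_mset (\<lambda>x. p \<le> x) (mset xs))"

lemma left_add_parts_ge:
  assumes "left_add i \<alpha> = Some \<beta>" "1 \<le> p"
  shows "parts_ge p (parts \<beta>) = parts_ge p (parts \<alpha>) + of_bool (i = p)"
proof (cases "i = 1")
  case True
  then have "parts \<beta> = 1 # parts \<alpha>" using assms(1) left_add_1 by simp
  then show ?thesis using assms(2) True by (auto simp: parts_ge_def)
next
  case False
  then obtain k where k: "k < length (parts \<alpha>)" "2 \<le> i" "parts \<alpha> ! k = i - 1" "parts \<beta> = (parts \<alpha>)[k := i]"
    using assms(1) left_add_Some_iff by blast
  define M where "M = mset (parts \<alpha>) - {#i - 1#}"
  have "i - 1 \<in># mset (parts \<alpha>)" using k by (metis nth_mem set_mset_mset)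
  then have "mset (parts \<alpha>) = add_mset (i - 1) M" by (simp add: M_def)
  moreover have "mset (parts \<beta>) = add_mset i M" using k by (simp add: M_def mset_update)
  ultimately show ?thesis using k(2) by (auto simp: parts_ge_def)
qed

lemma left_adds_parts_ge:
  assumes "left_adds is \<alpha> = Some \<beta>" "1 \<le> p"
  shows "parts_ge p (parts \<beta>) = parts_ge p (parts \<alpha>) + count_list is p"
  using assms(1)
proof (induction "is" arbitrary: \<beta> rule: rev_induct)
  case (snoc i js)
  then obtain \<gamma> where "left_adds js \<alpha> = Some \<gamma>" "left_add i \<gamma> = Some \<beta>"
    by (auto simp: left_adds_snoc bind_eq_Some_conv)
  then show ?case using snoc.IH left_add_parts_ge[OF _ assms(2)] by simp
qed simp

text \<open>Each \<open>t_i\<close> adds one box to column i and changes no other column length, so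
  the column lengths of \<alpha> and \<beta> tell how often every letter occurs.\<close>

lemma left_adds_mset_eq:
  assumes "left_adds is \<alpha> = Some \<beta>" "left_adds js \<alpha> = Some \<beta>" "\<forall>i\<in>set is. 1 \<le> i" "\<forall>j\<in>set js. 1 \<le> j"
  shows "mset is = mset js"
proof (rule multiset_eqI)
  fix p show "count (mset is) p = count (mset js) p"
  proof (cases "1 \<le> p")
    case True
    then show ?thesis
      using left_adds_parts_ge[OF assms(1)] left_adds_parts_ge[OF assms(2)] by (simp add: count_mset)
  next
    case False
    then have "p \<notin> set is" "p \<notin> set js" using assms(3,4) by auto
    then show ?thesis by (simp add: count_mset)
  qed
qed

section \<open>Words of operators between two compositions\<close>

definition add_words :: "nat \<Rightarrow> composition \<Rightarrow> composition \<Rightarrow> nat list set" where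
  "add_words n \<alpha> \<beta> = {is. length is = n \<and> (\<forall>i\<in>set is. 1 \<le> i) \<and> left_adds is \<alpha> = Some \<beta>}"

lemma finite_add_words: "finite (add_words n \<alpha> \<beta>)"
proof (cases "add_words n \<alpha> \<beta> = {}")
  case False
  then obtain w where w: "w \<in> add_words n \<alpha> \<beta>" by blast
  have "mset v = mset w" if "v \<in> add_words n \<alpha> \<beta>" for v
    using that w left_adds_mset_eq unfolding add_words_def by blast
  then have "add_words n \<alpha> \<beta> \<subseteq> {v. mset v = mset w}" by blast
  then show ?thesis by (rule finite_subset) (rule mset_eq_finite)
qed simp

lemma decreasing_word_unique:
  assumes "sorted_wrt (\<ge>) v" "sorted_wrt (\<ge>) w" "mset v = mset w"
  shows "v = (w :: nat list)"
proof -
  have "sorted (rev v)" "sorted (rev w)" using assms by (simp_all add: sorted_wrt_rev)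
  then have "rev v = rev w" using properties_for_sort[of "rev v" "rev w"] assms(3)
    by (simp add: sorted_sort_id)
  then show ?thesis by simp
qed

lemma increasing_word_unique:
  assumes "sorted_wrt (<) v" "sorted_wrt (<) w" "mset v = mset w"
  shows "v = (w :: nat list)"
  using strict_sorted_equal[OF assms(1,2)] mset_eq_setD[OF assms(3)] by simp

lemma add_words_append:
  "v @ w \<in> add_words (b + a) \<alpha> \<beta> \<and> length v = b \<longleftrightarrow> (\<exists>\<sigma>. v \<in> add_words b \<alpha> \<sigma> \<and> w \<in> add_words a \<sigma> \<beta>)"
  by (auto simp: add_words_def left_adds_append bind_eq_Some_conv)

definition dec_inc_at :: "nat \<Rightarrow> nat list \<Rightarrow> bool" where
  "dec_inc_at b w \<longleftrightarrow> sorted_wrt (\<ge>) (take b w) \<and> sorted_wrt (<) (drop b w)"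

lemma LV_iff_add_words: "LV b \<alpha> \<sigma> \<longleftrightarrow> (\<exists>v\<in>add_words b \<alpha> \<sigma>. sorted_wrt (\<ge>) v)"
  by (auto simp: LV_def add_words_def)

lemma LH_iff_add_words: "LH a \<sigma> \<rho> \<longleftrightarrow> (\<exists>w\<in>add_words a \<sigma> \<rho>. sorted_wrt (<) w)"
  by (auto simp: LH_def add_words_def)

text \<open>A word cut at b passes through an intermediate composition \<sigma>. Conversely \<sigma>
  determines the word: its endpoints fix the letters of either half, and the monotonicity of each
  half fixes their order.\<close>

lemma card_LV_LH_pairs:
  assumes "b \<le> n"
  shows "card {\<sigma>. LV b \<alpha> \<sigma> \<and> LH (n - b) \<sigma> \<rho>} = card {w \<in> add_words n \<alpha> \<rho>. dec_inc_at b w}"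
proof (rule sym, rule bij_betw_same_card, rule bij_betw_imageI)
  let ?f = "\<lambda>w. the (left_adds (take b w) \<alpha>)"
  have split: "\<exists>\<sigma>. take b w \<in> add_words b \<alpha> \<sigma> \<and> drop b w \<in> add_words (n - b) \<sigma> \<rho>"
    if "w \<in> add_words n \<alpha> \<rho>" for w
  proof -
    have "length w = n" using that by (simp add: add_words_def)
    then show ?thesis
      using that assms add_words_append[of "take b w" "drop b w" b "n - b" \<alpha> \<rho>] by simp
  qed
  have f: "?f w = \<sigma>" if "take b w \<in> add_words b \<alpha> \<sigma>" for w \<sigma>
    using that by (simp add: add_words_def)
  show "inj_on ?f {w \<in> add_words n \<alpha> \<rho>. dec_inc_at b w}"
  proof (rule inj_onI)
    fix v w assume v: "v \<in> {w \<in> add_words n \<alpha> \<rho>. dec_inc_at b w}" and w: "w \<in> {w \<in> add_words n \<alpha> \<rho>. dec_inc_at b w}"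
      and eq: "?f v = ?f w"
    obtain \<sigma> where \<sigma>: "take b v \<in> add_words b \<alpha> \<sigma>" "drop b v \<in> add_words (n - b) \<sigma> \<rho>" using split[of v] v by auto
    obtain \<tau> where \<tau>: "take b w \<in> add_words b \<alpha> \<tau>" "drop b w \<in> add_words (n - b) \<tau> \<rho>" using split[of w] w by auto
    have "\<tau> = \<sigma>" using eq f \<sigma>(1) \<tau>(1) by simp
    then have "mset (take b v) = mset (take b w)" "mset (drop b v) = mset (drop b w)"
      using \<sigma> \<tau> left_adds_mset_eq[of "take b v" \<alpha> \<sigma> "take b w"] left_adds_mset_eq[of "drop b v" \<sigma> \<rho> "drop b w"]
      by (simp_all add: add_words_def)
    then have "take b v = take b w" "drop b v = drop b w"
      using v w decreasing_word_unique[of "take b v" "take b w"] increasing_word_unique[of "drop b v" "drop b w"]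
      by (simp_all add: dec_inc_at_def)
    then show "v = w" by (metis append_take_drop_id)
  qed
  show "?f ` {w \<in> add_words n \<alpha> \<rho>. dec_inc_at b w} = {\<sigma>. LV b \<alpha> \<sigma> \<and> LH (n - b) \<sigma> \<rho>}"
  proof (intro equalityI subsetI)
    fix \<sigma> assume "\<sigma> \<in> ?f ` {w \<in> add_words n \<alpha> \<rho>. dec_inc_at b w}"
    then obtain w where w: "w \<in> add_words n \<alpha> \<rho>" "dec_inc_at b w" "\<sigma> = ?f w" by blast
    then obtain \<tau> where \<tau>: "take b w \<in> add_words b \<alpha> \<tau>" "drop b w \<in> add_words (n - b) \<tau> \<rho>" using split[of w] by auto
    then have "\<tau> = \<sigma>" using w f by simp
    then show "\<sigma> \<in> {\<sigma>. LV b \<alpha> \<sigma> \<and> LH (n - b) \<sigma> \<rho>}"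
      using \<tau> w(2) unfolding LV_iff_add_words LH_iff_add_words dec_inc_at_def by blast
  next
    fix \<sigma> assume "\<sigma> \<in> {\<sigma>. LV b \<alpha> \<sigma> \<and> LH (n - b) \<sigma> \<rho>}"
    then obtain v w where vw: "v \<in> add_words b \<alpha> \<sigma>" "sorted_wrt (\<ge>) v" "w \<in> add_words (n - b) \<sigma> \<rho>" "sorted_wrt (<) w"
      unfolding LV_iff_add_words LH_iff_add_words by blast
    have "v @ w \<in> add_words (b + (n - b)) \<alpha> \<rho>" using add_words_append vw(1,3) by blast
    then have "v @ w \<in> add_words n \<alpha> \<rho>" using assms by simp
    moreover have "length v = b" using vw by (simp add: add_words_def)
    ultimately have "v @ w \<in> {w \<in> add_words n \<alpha> \<rho>. dec_inc_at b w}" "?f (v @ w) = \<sigma>"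
      using vw f[of "v @ w" \<sigma>] by (simp_all add: dec_inc_at_def)
    then show "\<sigma> \<in> ?f ` {w \<in> add_words n \<alpha> \<rho>. dec_inc_at b w}" by (metis (no_types, lifting) imageI)
  qed
qed

lemma dec_inc_at_iff:
  assumes "b \<le> length w"
  shows "dec_inc_at b w \<longleftrightarrow> (\<forall>i. Suc i < b \<longrightarrow> w ! Suc i \<le> w ! i) \<and>
    (\<forall>i. b \<le> i \<and> Suc i < length w \<longrightarrow> w ! i < w ! Suc i)"
proof -
  have "sorted_wrt (\<ge>) (take b w) \<longleftrightarrow> (\<forall>i. Suc i < b \<longrightarrow> w ! Suc i \<le> w ! i)"
    using assms by (subst sorted_wrt_iff_nth_Suc_transp) (auto simp: transp_def)
  moreover have "sorted_wrt (<) (drop b w) \<longleftrightarrow> (\<forall>i. b \<le> i \<and> Suc i < length w \<longrightarrow> w ! i < w ! Suc i)"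
  proof (subst sorted_wrt_iff_nth_Suc_transp)
    show "(\<forall>i. Suc i < length (drop b w) \<longrightarrow> drop b w ! i < drop b w ! Suc i) \<longleftrightarrow>
        (\<forall>i. b \<le> i \<and> Suc i < length w \<longrightarrow> w ! i < w ! Suc i)" (is "?l \<longleftrightarrow> ?r")
    proof
      assume l: ?l
      show ?r
      proof (intro allI impI)
        fix i assume i: "b \<le> i \<and> Suc i < length w"
        then have "Suc (i - b) < length (drop b w)" unfolding length_drop by arith
        from l[rule_format, OF this] show "w ! i < w ! Suc i" using i by simp
      qed
    qed (use assms in auto)
  qed (auto simp: transp_def)
  ultimately show ?thesis by (simp add: dec_inc_at_def)
qed

text \<open>If some cut splits the word into a decreasing prefix and an increasing suffix, then exactly two
  adjacent cuts do: the smallest letter at the cut can be put on either side.\<close>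

lemma dec_inc_at_alternating_sum:
  assumes "w \<noteq> []"
  shows "(\<Sum>b\<le>length w. (- 1) ^ b * of_bool (dec_inc_at b w)) = (0 :: int)"
proof -
  let ?n = "length w"
  let ?D = "\<lambda>b. b \<le> ?n \<and> dec_inc_at b w"
  \<comment> \<open>Two valid cuts further apart would put the letters at b and b + 1 both in a
    decreasing prefix and in an increasing suffix.\<close>
  have adj: "c = Suc b" if "?D b" "?D c" "b < c" for b c
  proof (rule ccontr)
    assume "c \<noteq> Suc b"
    then have "Suc b < c" using that by simp
    then have "w ! Suc b \<le> w ! b" "w ! b < w ! Suc b" using that dec_inc_at_iff by auto
    then show False by simp
  qed
  \<comment> \<open>At an inner cut the letters on its two sides are compared: if the right one is
    not larger it joins the prefix, otherwise the left one joins the suffix. At either end of the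
    word only one move is possible, and it succeeds because the other side is empty.\<close>
  have partner: "?D (Suc b) \<or> 0 < b \<and> ?D (b - 1)" if D: "?D b" for b
  proof -
    note b = D[THEN conjunct2, unfolded dec_inc_at_iff[OF D[THEN conjunct1]]]
    consider "b = 0" | "b = ?n" | "0 < b" "b < ?n" "w ! b \<le> w ! (b - 1)" | "0 < b" "b < ?n" "w ! (b - 1) < w ! b"
      using D by linarith
    then show ?thesis
    proof cases
      case 1
      then show ?thesis using b assms by (auto simp: dec_inc_at_iff Suc_le_eq)
    next
      case 2
      then show ?thesis using b assms by (auto simp: dec_inc_at_iff)
    next
      case 3
      have "w ! Suc i \<le> w ! i" if "Suc i < Suc b" for i
        using b 3 that by (cases "Suc i = b") auto
      then show ?thesis using b 3 by (auto simp: dec_inc_at_iff Suc_le_eq)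
    next
      case 4
      have "w ! i < w ! Suc i" if "b - 1 \<le> i" "Suc i < ?n" for i
        using b 4 that by (cases "Suc i = b") auto
      then show ?thesis using b 4 by (auto simp: dec_inc_at_iff)
    qed
  qed
  show ?thesis
  proof (cases "\<exists>b. ?D b")
    case False
    then show ?thesis by (intro sum.neutral) auto
  next
    case True
    then obtain c where c: "?D c" by blast
    \<comment> \<open>The smaller of the two valid cuts; their signs are opposite.\<close>
    define b where "b = (if ?D (Suc c) then c else c - 1)"
    have b: "?D b" "?D (Suc b)" using partner[OF c] c by (auto simp: b_def)
    have "{b. ?D b} = {b, Suc b}"
    proof (intro equalityI subsetI)
      fix c assume "c \<in> {b. ?D b}"
      then have c: "?D c" by simp
      have "c < b \<longrightarrow> b = Suc c" "c < Suc b \<longrightarrow> Suc b = Suc c" "b < c \<longrightarrow> c = Suc b"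
        using adj[OF c b(1)] adj[OF c b(2)] adj[OF b(1) c] by blast+
      then have "c = b \<or> c = Suc b" by linarith
      then show "c \<in> {b, Suc b}" by blast
    qed (use b in blast)
    moreover have "(\<Sum>b\<le>?n. (- 1) ^ b * of_bool (dec_inc_at b w)) = (\<Sum>b\<in>{b. ?D b}. (- 1) ^ b :: int)"
      by (intro sum.mono_neutral_cong_right) auto
    ultimately show ?thesis by simp
  qed
qed

text \<open>Exchanging the sums groups the pairs of strips by their words, and every word of
  positive length contributes 0.\<close>

lemma alternating_sum_LV_LH:
  assumes "0 < n"
  shows "(\<Sum>b\<le>n. (- 1) ^ b * int (card {\<sigma>. LV b \<alpha> \<sigma> \<and> LH (n - b) \<sigma> \<rho>})) = 0"
proof -
  have "(\<Sum>b\<le>n. (- 1) ^ b * int (card {\<sigma>. LV b \<alpha> \<sigma> \<and> LH (n - b) \<sigma> \<rho>})) =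
      (\<Sum>b\<le>n. \<Sum>w\<in>add_words n \<alpha> \<rho>. (- 1) ^ b * of_bool (dec_inc_at b w))"
  proof (intro sum.cong refl)
    fix b assume "b \<in> {..n}"
    then have "int (card {\<sigma>. LV b \<alpha> \<sigma> \<and> LH (n - b) \<sigma> \<rho>}) = (\<Sum>w\<in>add_words n \<alpha> \<rho>. of_bool (dec_inc_at b w))"
      by (simp add: card_LV_LH_pairs sum.If_cases finite_add_words of_bool_def Int_def)
    then show "(- 1) ^ b * int (card {\<sigma>. LV b \<alpha> \<sigma> \<and> LH (n - b) \<sigma> \<rho>}) =
        (\<Sum>w\<in>add_words n \<alpha> \<rho>. (- 1) ^ b * of_bool (dec_inc_at b w))"
      by (simp only: sum_distrib_left)
  qed
  also have "\<dots> = (\<Sum>w\<in>add_words n \<alpha> \<rho>. \<Sum>b\<le>n. (- 1) ^ b * of_bool (dec_inc_at b w))"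
    by (rule sum.swap)
  also have "\<dots> = 0"
  proof (rule sum.neutral, rule ballI)
    fix w assume "w \<in> add_words n \<alpha> \<rho>"
    then have "length w = n" by (simp add: add_words_def)
    then show "(\<Sum>b\<le>n. (- 1) ^ b * of_bool (dec_inc_at b w)) = (0 :: int)"
      using dec_inc_at_alternating_sum[of w] assms by auto
  qed
  finally show ?thesis .
qed

text \<open>On the empty composition only \<open>t_1\<close> is nonzero, and a weakly decreasing
  word of positive letters that starts with 1 consists of 1s.\<close>

lemma LV_zero_iff: "LV n 0 \<beta> \<longleftrightarrow> \<beta> = column_comp n"
proof -
  have col: "left_adds (replicate n 1) 0 = Some (column_comp n)" for n
  proof (induction n)
    case (Suc n)
    have "left_adds (replicate n 1 @ [1]) 0 = left_add 1 (column_comp n)"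
      using Suc by (simp add: left_adds_snoc)
    also have "\<dots> = Some (column_comp (Suc n))"
      unfolding left_add_1 by (simp add: column_comp.rep_eq)
    finally show ?case by (simp add: replicate_append_same)
  qed simp
  show ?thesis
  proof
    assume "LV n 0 \<beta>"
    then obtain w where w: "length w = n" "\<forall>i\<in>set w. 1 \<le> i" "sorted_wrt (\<ge>) w" "left_adds w 0 = Some \<beta>"
      unfolding LV_def by blast
    have "\<forall>i\<in>set w. i = 1"
    proof (cases w)
      case (Cons i js)
      have "left_adds ([i] @ js) 0 = Option.bind (left_add i 0) (left_adds js)"
        unfolding left_adds_append left_adds_single ..
      then obtain \<gamma> where "left_add i 0 = Some \<gamma>" using w(4) Cons by (auto simp: bind_eq_Some_conv)
      then have "i = 1" using left_add_Some_iff[of i 0 \<gamma>] by auto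
      then show ?thesis using w(2,3) Cons by fastforce
    qed simp
    then have "w = replicate n 1" using w(1) by (simp add: replicate_eqI)
    then show "\<beta> = column_comp n" using w(4) col by simp
  next
    assume "\<beta> = column_comp n"
    then show "LV n 0 \<beta>"
      unfolding LV_def using col by (intro exI[of _ "replicate n 1"]) (auto simp: sorted_wrt_iff_nth_less)
  qed
qed

lemma LH_zero_iff: "LH n 0 \<beta> \<longleftrightarrow> \<beta> = row_comp n"
proof (cases "n = 0")
  case True
  then show ?thesis by (auto simp: LH_0)
next
  case False
  have "\<not> LH n 0 \<beta>" if "\<beta> \<noteq> row_comp n"
  proof
    assume "LH n 0 \<beta>"
    then obtain X where "X \<in> {[], [0]}" "hstrip X (parts \<beta>)" "sum_list (parts \<beta>) = sum_list X + n"
      unfolding LH_iff parts_0 by blast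
    then have "length (parts \<beta>) \<le> 1" "sum_list (parts \<beta>) = n" using hstrip_length[of X "parts \<beta>"] by auto
    then have "parts \<beta> = [n]" using False by (cases "parts \<beta>") auto
    then have "parts \<beta> = parts (row_comp n)" using False by (simp add: row_comp.rep_eq)
    then show False using that by (simp add: parts_inject)
  qed
  then show ?thesis using LH_row_comp_plus[of n 0] by auto
qed

lemma nc_schur_row_comp: "nc_schur (row_comp n) = (H (row_comp n) :: 'a::field_char_0 nsym)"
  using H_row_mult_nc_schur[of n 0, where 'a = 'a] by (simp add: LH_zero_iff nc_schur_0)

text \<open>After the Pieri rule for rows, the coefficient of each \<open>nc_schur \<rho>\<close> is
  the alternating number of strip pairs from \<alpha> to \<rho>. The bounded set \<open>?R\<close>
  is an index set common to all b. For \<alpha> = 0 the vertical strips are columns, which gives the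
  relation between rows and columns.\<close>

lemma sum_H_row_mult_LV_nc_schur:
  "(\<Sum>b\<le>n. (- 1) ^ b * (H (row_comp (n - b)) * (\<Sum>\<sigma> | LV b \<alpha> \<sigma>. nc_schur \<sigma>))) =
     (if n = 0 then nc_schur \<alpha> else (0 :: 'a::field_char_0 nsym))"
proof (cases "n = 0")
  case True
  then show ?thesis by (simp add: LV_0)
next
  case False
  let ?R = "{\<rho>. sum_list (parts \<rho>) \<le> sum_list (parts \<alpha>) + n}"
  have fin: "finite ?R" by (rule finite_composition_size)
  have "H (row_comp (n - b)) * (\<Sum>\<sigma> | LV b \<alpha> \<sigma>. nc_schur \<sigma>) =
      (\<Sum>\<rho>\<in>?R. of_nat (card {\<sigma>. LV b \<alpha> \<sigma> \<and> LH (n - b) \<sigma> \<rho>}) * (nc_schur \<rho> :: 'a nsym))"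
    if "b \<le> n" for b
  proof -
    have "H (row_comp (n - b)) * (\<Sum>\<sigma> | LV b \<alpha> \<sigma>. nc_schur \<sigma>) =
        (\<Sum>\<sigma>\<in>{\<sigma>. LV b \<alpha> \<sigma>}. \<Sum>\<rho> | LH (n - b) \<sigma> \<rho>. nc_schur \<rho> :: 'a nsym)"
      by (simp add: sum_distrib_left H_row_mult_nc_schur)
    also have "\<dots> = (\<Sum>\<sigma>\<in>{\<sigma>. LV b \<alpha> \<sigma>}. \<Sum>\<rho> | \<rho> \<in> ?R \<and> LH (n - b) \<sigma> \<rho>. nc_schur \<rho>)"
    proof (intro sum.cong refl)
      fix \<sigma> assume "\<sigma> \<in> {\<sigma>. LV b \<alpha> \<sigma>}"
      then show "{\<rho>. LH (n - b) \<sigma> \<rho>} = {\<rho>. \<rho> \<in> ?R \<and> LH (n - b) \<sigma> \<rho>}"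
        using that LV_size[of b \<alpha> \<sigma>] LH_size[of "n - b" \<sigma>] by auto
    qed
    also have "\<dots> = (\<Sum>\<rho>\<in>?R. \<Sum>\<sigma> | \<sigma> \<in> {\<sigma>. LV b \<alpha> \<sigma>} \<and> LH (n - b) \<sigma> \<rho>. nc_schur \<rho>)"
      by (rule sum.swap_restrict[OF _ fin]) simp
    finally show ?thesis by simp
  qed
  then have "(\<Sum>b\<le>n. (- 1) ^ b * (H (row_comp (n - b)) * (\<Sum>\<sigma> | LV b \<alpha> \<sigma>. nc_schur \<sigma>))) =
      (\<Sum>b\<le>n. \<Sum>\<rho>\<in>?R. (- 1) ^ b * of_nat (card {\<sigma>. LV b \<alpha> \<sigma> \<and> LH (n - b) \<sigma> \<rho>}) * (nc_schur \<rho> :: 'a nsym))"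
    by (simp add: sum_distrib_left mult.assoc)
  also have "\<dots> = (\<Sum>\<rho>\<in>?R. of_int (\<Sum>b\<le>n. (- 1) ^ b * int (card {\<sigma>. LV b \<alpha> \<sigma> \<and> LH (n - b) \<sigma> \<rho>})) * nc_schur \<rho>)"
    by (subst sum.swap) (simp add: sum_distrib_right)
  also have "\<dots> = 0" using False by (simp only: alternating_sum_LV_LH) simp
  finally show ?thesis using False by simp
qed

text \<open>Both sides solve the same system: the signed sum of \<open>H_(n-b)\<close> times the
  b-th unknown is \<open>nc_schur \<alpha>\<close> for n = 0 and 0 otherwise. The system is
  triangular with leading coefficient \<open>H_0 = 1\<close> up to sign, so its solution is
  unique.\<close>

lemma nc_schur_column_mult_nc_schur:
  "nc_schur (column_comp n) * nc_schur \<alpha> = (\<Sum>\<rho> | LV n \<alpha> \<rho>. nc_schur \<rho> :: 'a::field_char_0 nsym)"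
proof (induction n rule: less_induct)
  case (less n)
  let ?V = "\<lambda>b. \<Sum>\<rho> | LV b \<alpha> \<rho>. nc_schur \<rho> :: 'a nsym"
  let ?H = "\<lambda>b. H (row_comp b) :: 'a nsym"
  have "(\<Sum>b\<le>n. (- 1) ^ b * (?H (n - b) * nc_schur (column_comp b))) = (if n = 0 then 1 else 0)"
    using sum_H_row_mult_LV_nc_schur[of n 0, where 'a = 'a] by (simp add: LV_zero_iff nc_schur_0)
  then have "(\<Sum>b\<le>n. (- 1) ^ b * (?H (n - b) * nc_schur (column_comp b))) * nc_schur \<alpha> =
      (if n = 0 then nc_schur \<alpha> else 0)"
    by simp
  then have "(\<Sum>b\<le>n. (- 1) ^ b * (?H (n - b) * (nc_schur (column_comp b) * nc_schur \<alpha>))) =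
      (\<Sum>b\<le>n. (- 1) ^ b * (?H (n - b) * ?V b))"
    by (simp only: sum_H_row_mult_LV_nc_schur sum_distrib_right mult.assoc)
  moreover have "(\<Sum>b<n. (- 1) ^ b * (?H (n - b) * (nc_schur (column_comp b) * nc_schur \<alpha>))) =
      (\<Sum>b<n. (- 1) ^ b * (?H (n - b) * ?V b))"
    using less by (intro sum.cong) auto
  \<comment> \<open>The terms with b < n agree by induction, which leaves the term b = n, where the
    factor is \<open>H_0 = 1\<close>.\<close>
  ultimately have "(- 1) ^ n * (nc_schur (column_comp n) * nc_schur \<alpha>) = (- 1) ^ n * ?V n"
    by (simp add: lessThan_Suc_atMost[symmetric])
  then have "(- 1) ^ n * ((- 1) ^ n * (nc_schur (column_comp n) * nc_schur \<alpha>)) = (- 1) ^ n * ((- 1) ^ n * ?V n)"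
    by (rule arg_cong)
  then show ?case by (simp add: mult.assoc[symmetric] power_add[symmetric] mult_2[symmetric])
qed

section \<open>Coproduct and skewing\<close>

lemma tensor_single: "tensor (Poly_Mapping.single \<alpha> c) (Poly_Mapping.single \<beta> d) = Poly_Mapping.single (\<alpha>, \<beta>) (c * d)"
  by (cases "c = 0"; cases "d = 0") (simp_all add: tensor_def)

lemma tensor_0 [simp]: "tensor 0 h = 0" "tensor g 0 = 0"
  by (simp_all add: tensor_def)

lemma tensor_add_left: "tensor (g + g') h = tensor g h + tensor g' h"
  unfolding tensor_def
  by (rule sum_keys_add[where f = "\<lambda>\<alpha> x. \<Sum>\<beta>\<in>Poly_Mapping.keys h. Poly_Mapping.single (\<alpha>, \<beta>) (x * Poly_Mapping.lookup h \<beta>)"])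
    (simp_all add: distrib_right single_add sum.distrib)

lemma tensor_add_right: "tensor (g :: 'a::semiring_1 nsym) (h + h') = tensor g h + tensor g h'"
proof -
  have "(\<Sum>\<beta>\<in>Poly_Mapping.keys (h + h'). Poly_Mapping.single (\<alpha>, \<beta>) (x * Poly_Mapping.lookup (h + h') \<beta>)) =
      (\<Sum>\<beta>\<in>Poly_Mapping.keys h. Poly_Mapping.single (\<alpha>, \<beta>) (x * Poly_Mapping.lookup h \<beta>)) +
      (\<Sum>\<beta>\<in>Poly_Mapping.keys h'. Poly_Mapping.single (\<alpha>, \<beta>) (x * Poly_Mapping.lookup h' \<beta>))" for \<alpha> :: composition and x :: 'a
    by (rule sum_keys_add[where f = "\<lambda>\<beta> y. Poly_Mapping.single (\<alpha>, \<beta>) (x * y)"])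
      (simp_all add: distrib_left single_add)
  then show ?thesis unfolding tensor_def by (simp only: sum.distrib)
qed

lemma tensor_sum_right: "tensor g (sum h A) = (\<Sum>x\<in>A. tensor g (h x))"
  by (induction A rule: infinite_finite_induct) (simp_all add: tensor_add_right)

lemma tensor_1_1 [simp]: "tensor 1 1 = 1"
proof -
  have "tensor (Poly_Mapping.single 0 1) (Poly_Mapping.single 0 1) = Poly_Mapping.single (0, 0) (1 :: 'a)"
    by (simp only: tensor_single mult_1_left)
  then show ?thesis by (simp flip: zero_prod_def)
qed

lemma tensor_mult:
  fixes g :: "'a::comm_ring_1 nsym"
  shows "tensor g h * tensor g' h' = tensor (g * g') (h * h')"
proof (induction g rule: poly_mapping_add_induct)
  case (single \<alpha> c)
  show ?case
  proof (induction h rule: poly_mapping_add_induct)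
    case (single \<beta> d)
    show ?case
    proof (induction g' rule: poly_mapping_add_induct)
      case (single \<gamma> e)
      show ?case
        by (induction h' rule: poly_mapping_add_induct)
          (simp_all add: tensor_add_right distrib_left tensor_single mult_single plus_prod_def ac_simps)
    qed (simp_all add: tensor_add_left distrib_left)
  qed (simp_all add: tensor_add_right distrib_right)
qed (simp_all add: tensor_add_left distrib_right)

lemma tensor_scale:
  fixes g :: "'a::comm_ring_1 nsym"
  shows "tensor (g * Poly_Mapping.single 0 c) h = tensor g (Poly_Mapping.single 0 c * h)"
proof (induction g rule: poly_mapping_add_induct)
  case (single \<alpha> d)
  show ?case
    by (induction h rule: poly_mapping_add_induct)
      (simp_all add: tensor_add_right distrib_left tensor_single mult_single ac_simps)
qed (simp_all add: tensor_add_left distrib_right)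

text \<open>The map id \<otimes> <-, f>. Taken with \<open>qsym_schur \<eta>\<close> it extracts the
  left-hand coefficient of \<open>nc_schur \<eta>\<close>.\<close>

definition right_pairing :: "'a::semiring_1 nsym2 \<Rightarrow> 'a series \<Rightarrow> 'a nsym" where
  "right_pairing X f = (\<Sum>p\<in>Poly_Mapping.keys X. Poly_Mapping.single (fst p) (Poly_Mapping.lookup X p * f (initial_monomial (snd p))))"

lemma right_pairing_0 [simp]: "right_pairing 0 f = 0"
  by (simp add: right_pairing_def)

lemma right_pairing_add: "right_pairing (X + Y) f = right_pairing X f + right_pairing Y f"
  unfolding right_pairing_def
  by (rule sum_keys_add[where f = "\<lambda>p x. Poly_Mapping.single (fst p) (x * f (initial_monomial (snd p)))"])
    (simp_all add: distrib_right single_add)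

lemma right_pairing_sum: "right_pairing (sum X A) f = (\<Sum>x\<in>A. right_pairing (X x) f)"
  by (induction A rule: infinite_finite_induct) (simp_all add: right_pairing_add)

lemma right_pairing_minus: "right_pairing (- X) (f :: 'a::ring_1 series) = - right_pairing X f"
proof -
  have "right_pairing (- X) f + right_pairing X f = 0" by (simp flip: right_pairing_add)
  then show ?thesis by (simp add: eq_neg_iff_add_eq_0)
qed

lemma right_pairing_neg_one_power:
  "right_pairing ((- 1) ^ n * X) (f :: 'a::ring_1 series) = (- 1) ^ n * right_pairing X f"
  by (cases "even n") (simp_all add: right_pairing_minus)

lemma right_pairing_single:
  "right_pairing (Poly_Mapping.single (\<alpha>, \<beta>) c) f = Poly_Mapping.single \<alpha> (c * f (initial_monomial \<beta>))"
  by (cases "c = 0") (simp_all add: right_pairing_def)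

lemma right_pairing_tensor:
  fixes g :: "'a::comm_ring_1 nsym"
  shows "right_pairing (tensor g h) f = g * Poly_Mapping.single 0 (pairing h f)"
proof (induction g rule: poly_mapping_add_induct)
  case (single \<alpha> c)
  show ?case
    by (induction h rule: poly_mapping_add_induct)
      (simp_all add: tensor_add_right distrib_left tensor_single mult_single right_pairing_single
        right_pairing_add pairing_single pairing_add single_add mult.assoc)
qed (simp_all add: tensor_add_left distrib_right right_pairing_add)

lemma nsym2_induct [case_names zero tensor add]:
  assumes "P 0" "\<And>g h. P (tensor g h)" "\<And>X Y. P X \<Longrightarrow> P Y \<Longrightarrow> P (X + Y)"
  shows "P (X :: 'a::semiring_1 nsym2)"
proof (induction X rule: poly_mapping_add_induct)
  case (single p c)
  have "Poly_Mapping.single p c = tensor (Poly_Mapping.single (fst p) c) (Poly_Mapping.single (snd p) 1)"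
    by (simp add: tensor_single)
  then show ?case using assms(2) by simp
qed (use assms in auto)

lemma right_pairing_mult_left:
  fixes X :: "'a::comm_ring_1 nsym2"
  shows "right_pairing (tensor g 1 * X) f = g * right_pairing X f"
  by (induction X rule: nsym2_induct)
    (simp_all add: tensor_mult right_pairing_tensor distrib_left right_pairing_add mult.assoc)

text \<open>Multiplication by e in the right factor is moved onto f as an adjoint; M and F will
  range over the strips ending at a fixed composition.\<close>

lemma right_pairing_mult_right:
  fixes X :: "'a::comm_ring_1 nsym2"
  assumes "\<And>h. pairing (e * h) f = (\<Sum>\<mu>\<in>M. pairing h (F \<mu>))"
  shows "right_pairing (tensor 1 e * X) f = (\<Sum>\<mu>\<in>M. right_pairing X (F \<mu>))"
  by (induction X rule: nsym2_induct)
    (simp_all add: tensor_mult right_pairing_tensor distrib_left right_pairing_add assms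
      single_sum sum_distrib_left sum.distrib)

lemma right_pairing_tensor_nc_schur:
  "right_pairing (tensor g (nc_schur \<eta>)) (qsym_schur \<gamma>) = (if \<eta> = \<gamma> then g else (0 :: 'a::field_char_0 nsym))"
  by (simp add: right_pairing_tensor pairing_nc_schur)

text \<open>Asserting the expansion for all sufficiently large finite B, and not just for one set,
  lets the expansions of two summands be added over a common index set.\<close>

lemma nsym2_expansion:
  fixes X :: "'a::field_char_0 nsym2"
  shows "\<exists>A. finite A \<and> (\<forall>B. finite B \<and> A \<subseteq> B \<longrightarrow>
    X = (\<Sum>\<eta>\<in>B. tensor (right_pairing X (qsym_schur \<eta>)) (nc_schur \<eta>)))"
proof (induction X rule: poly_mapping_add_induct)
  case (single p c)
  obtain \<alpha> \<beta> where p: "p = (\<alpha>, \<beta>)" by fastforce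
  let ?A = "{\<eta>. sum_list (parts \<eta>) = sum_list (parts \<beta>)}"
  have X: "Poly_Mapping.single p c = tensor (Poly_Mapping.single \<alpha> c) (H \<beta>)"
    by (simp add: p H_def tensor_single)
  have "finite ?A" by (rule finite_subset[OF _ finite_composition_size[of "sum_list (parts \<beta>)"]]) auto
  moreover have "tensor (Poly_Mapping.single \<alpha> c) (H \<beta>) =
      (\<Sum>\<eta>\<in>B. tensor (right_pairing (tensor (Poly_Mapping.single \<alpha> c) (H \<beta>)) (qsym_schur \<eta>)) (nc_schur \<eta>))"
    if "finite B" "?A \<subseteq> B" for B
  proof -
    have "tensor (Poly_Mapping.single \<alpha> c) (H \<beta>) = (\<Sum>\<eta>\<in>B. tensor (Poly_Mapping.single \<alpha> c)
        (Poly_Mapping.single 0 (qsym_schur \<eta> (initial_monomial \<beta>)) * nc_schur \<eta>))"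
      unfolding nc_schur_eq_schur_rec tensor_sum_right[symmetric] by (subst H_eq_sum_schur_rec[OF that]) (rule refl)
    also have "\<dots> = (\<Sum>\<eta>\<in>B. tensor (right_pairing (tensor (Poly_Mapping.single \<alpha> c) (H \<beta>)) (qsym_schur \<eta>)) (nc_schur \<eta>))"
      by (simp only: right_pairing_tensor tensor_scale pairing_H)
    finally show ?thesis .
  qed
  ultimately show ?case unfolding X by blast
next
  case (add X Y)
  let ?exp = "\<lambda>X C. X = (\<Sum>\<eta>\<in>C. tensor (right_pairing X (qsym_schur \<eta>)) (nc_schur \<eta>))"
  from add(1) obtain A where A: "finite A \<and> (\<forall>C. finite C \<and> A \<subseteq> C \<longrightarrow> ?exp X C)" by (rule exE)
  from add(2) obtain B where B: "finite B \<and> (\<forall>C. finite C \<and> B \<subseteq> C \<longrightarrow> ?exp Y C)" by (rule exE)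
  have "X + Y = (\<Sum>\<eta>\<in>C. tensor (right_pairing (X + Y) (qsym_schur \<eta>)) (nc_schur \<eta>))"
    if "finite C" "A \<union> B \<subseteq> C" for C
    unfolding right_pairing_add tensor_add_left sum.distrib
    by (rule arg_cong2[where f = "(+)"]; rule A[THEN conjunct2, rule_format] B[THEN conjunct2, rule_format])
      (use that in simp_all)
  moreover have "finite (A \<union> B)" using A B by simp
  ultimately show ?case by blast
qed auto

text \<open>Existence comes from \<open>nsym2_expansion\<close>. Contracting a decomposition with
  \<open>qsym_schur \<gamma>\<close> isolates the coefficient of \<open>nc_schur \<gamma>\<close>;
  this gives uniqueness and also bounds the support by A.\<close>

lemma skew_nc_schur_eq:
  "skew_nc_schur \<Lambda> \<eta> = right_pairing (coproduct (nc_schur \<Lambda>)) (qsym_schur \<eta>)"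
proof -
  let ?X = "coproduct (nc_schur \<Lambda>) :: 'a nsym2"
  let ?g = "\<lambda>\<eta>. right_pairing ?X (qsym_schur \<eta>)"
  obtain A where A: "finite A" "?X = (\<Sum>\<eta>\<in>A. tensor (?g \<eta>) (nc_schur \<eta>))"
    using nsym2_expansion[of ?X] by blast
  have "?g \<gamma> = 0" if "\<gamma> \<notin> A" for \<gamma>
  proof -
    have "?g \<gamma> = right_pairing (\<Sum>\<eta>\<in>A. tensor (?g \<eta>) (nc_schur \<eta>)) (qsym_schur \<gamma>)"
      by (rule arg_cong[OF A(2), where f = "\<lambda>X. right_pairing X (qsym_schur \<gamma>)"])
    also have "\<dots> = 0" using that
      by (auto simp: right_pairing_sum right_pairing_tensor_nc_schur intro!: sum.neutral)
    finally show ?thesis .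
  qed
  then have sub: "{\<eta>. ?g \<eta> \<noteq> 0} \<subseteq> A" by blast
  have "skew_nc_schur \<Lambda> = ?g"
    unfolding skew_nc_schur_def
  proof (rule the_equality)
    have "?X = (\<Sum>\<eta> | ?g \<eta> \<noteq> 0. tensor (?g \<eta>) (nc_schur \<eta>))"
      by (rule trans[OF A(2)], rule sum.mono_neutral_right) (use A(1) sub in auto)
    then show "finite {\<eta>. ?g \<eta> \<noteq> 0} \<and> ?X = (\<Sum>\<eta> | ?g \<eta> \<noteq> 0. tensor (?g \<eta>) (nc_schur \<eta>))"
      using finite_subset[OF sub A(1)] by blast
  next
    fix g :: "composition \<Rightarrow> 'a nsym"
    assume g: "finite {\<eta>. g \<eta> \<noteq> 0} \<and> ?X = (\<Sum>\<eta> | g \<eta> \<noteq> 0. tensor (g \<eta>) (nc_schur \<eta>))"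
    show "g = ?g"
    proof
      fix \<gamma>
      have "?g \<gamma> = right_pairing (\<Sum>\<eta> | g \<eta> \<noteq> 0. tensor (g \<eta>) (nc_schur \<eta>)) (qsym_schur \<gamma>)"
        using arg_cong[OF conjunct2[OF g], where f = "\<lambda>X. right_pairing X (qsym_schur \<gamma>)"] .
      also have "\<dots> = g \<gamma>"
        using g by (simp add: right_pairing_sum right_pairing_tensor_nc_schur)
      finally show "g \<gamma> = ?g \<gamma>" by simp
    qed
  qed
  then show ?thesis by (rule fun_cong)
qed

section \<open>The coproduct is multiplicative\<close>

lemma coproduct_0 [simp]: "coproduct 0 = 0"
  by (simp add: coproduct_def)

lemma coproduct_single: "coproduct (Poly_Mapping.single \<alpha> c) = Poly_Mapping.single 0 c * coproduct (H \<alpha>)"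
  by (cases "c = 0") (simp_all add: coproduct_def H_def)

lemma coproduct_mult:
  fixes g h :: "'a::comm_ring_1 nsym"
  shows "coproduct (g * h) = coproduct g * coproduct h"
proof (induction g rule: poly_mapping_add_induct)
  case (single \<alpha> c)
  show ?case
  proof (induction h rule: poly_mapping_add_induct)
    case (single \<beta> d)
    have *: "coproduct (H \<alpha>) * (Poly_Mapping.single 0 d * Z) = Poly_Mapping.single 0 d * (coproduct (H \<alpha>) * Z)" for Z :: "'a nsym2"
      by (simp only: mult.assoc[symmetric] single_0_commute[of "coproduct (H \<alpha>)" d])
    have cd: "Poly_Mapping.single 0 (c * d) = Poly_Mapping.single 0 c * (Poly_Mapping.single 0 d :: 'a nsym2)"
      by (simp add: mult_single)
    show ?case
      unfolding mult_single[of \<alpha> c \<beta> d] coproduct_single cd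
      by (simp only: H_plus coproduct_H_mult mult.assoc *)
  qed (simp_all add: coproduct_add distrib_left)
qed (simp_all add: coproduct_add distrib_right)

lemma coproduct_1 [simp]: "coproduct 1 = 1"
  using coproduct_H[of 0] by simp

lemma coproduct_H_row: "coproduct (H (row_comp n)) = coproduct_gen n"
proof (cases "n = 0")
  case True
  then show ?thesis by (simp add: coproduct_gen_def)
next
  case False
  then show ?thesis by (simp add: coproduct_H row_comp.rep_eq)
qed

section \<open>Generating series of rows and columns\<close>

unbundle fps_syntax

definition fps_map :: "('a \<Rightarrow> 'b) \<Rightarrow> 'a fps \<Rightarrow> 'b::ring_1 fps" where
  "fps_map \<phi> F = Abs_fps (\<lambda>n. \<phi> (F $ n))"

definition ring_morphism :: "('a::ring_1 \<Rightarrow> 'b::ring_1) \<Rightarrow> bool" where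
  "ring_morphism \<phi> \<longleftrightarrow> \<phi> 1 = 1 \<and> (\<forall>x y. \<phi> (x + y) = \<phi> x + \<phi> y) \<and> (\<forall>x y. \<phi> (x * y) = \<phi> x * \<phi> y)"

lemma ring_morphism_0: "ring_morphism \<phi> \<Longrightarrow> \<phi> 0 = 0"
  unfolding ring_morphism_def by (metis add_cancel_right_left)

lemma ring_morphism_sum: "ring_morphism \<phi> \<Longrightarrow> \<phi> (sum f A) = (\<Sum>x\<in>A. \<phi> (f x))"
  by (induction A rule: infinite_finite_induct) (auto simp: ring_morphism_0 ring_morphism_def)

lemma ring_morphism_neg_one_power:
  assumes "ring_morphism \<phi>"
  shows "\<phi> ((- 1) ^ n * x) = (- 1) ^ n * \<phi> x"
proof -
  have "\<phi> (- x) + \<phi> x = \<phi> 0" using assms unfolding ring_morphism_def by (metis add.left_inverse)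
  then have "\<phi> (- x) = - \<phi> x" using ring_morphism_0[OF assms] by (simp add: eq_neg_iff_add_eq_0)
  then show ?thesis by (cases "even n") simp_all
qed

lemma fps_map_nth [simp]: "fps_map \<phi> F $ n = \<phi> (F $ n)"
  by (simp add: fps_map_def)

lemma fps_map_mult: "ring_morphism \<phi> \<Longrightarrow> fps_map \<phi> (F * G) = fps_map \<phi> F * fps_map \<phi> G"
  by (rule fps_ext) (simp add: fps_mult_nth ring_morphism_sum, simp add: ring_morphism_def)

lemma fps_map_1: "ring_morphism \<phi> \<Longrightarrow> fps_map \<phi> 1 = 1"
  by (rule fps_ext) (simp add: ring_morphism_0, simp add: ring_morphism_def)

lemma ring_morphism_tensor_left: "ring_morphism (\<lambda>g :: 'a::comm_ring_1 nsym. tensor g 1)"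
  by (simp add: ring_morphism_def tensor_add_left tensor_mult)

lemma ring_morphism_tensor_right: "ring_morphism (\<lambda>h :: 'a::comm_ring_1 nsym. tensor 1 h)"
  by (simp add: ring_morphism_def tensor_add_right tensor_mult)

lemma ring_morphism_coproduct: "ring_morphism (coproduct :: 'a::comm_ring_1 nsym \<Rightarrow> _)"
  by (simp add: ring_morphism_def coproduct_add coproduct_mult)

definition row_series :: "'a::field_char_0 nsym fps" where
  "row_series = Abs_fps (\<lambda>n. nc_schur (row_comp n))"

definition column_series :: "'a::field_char_0 nsym fps" where
  "column_series = Abs_fps (\<lambda>n. (- 1) ^ n * nc_schur (column_comp n))"

text \<open>Coefficientwise this is \<open>sum_H_row_mult_LV_nc_schur\<close> for the empty
  composition.\<close>

lemma row_series_mult_column_series: "row_series * column_series = (1 :: 'a::field_char_0 nsym fps)"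
proof (rule fps_ext)
  fix n
  have "(row_series * column_series) $ n =
      (\<Sum>b\<le>n. H (row_comp (n - b)) * ((- 1) ^ b * nc_schur (column_comp b)) :: 'a nsym)"
    unfolding fps_mult_nth row_series_def column_series_def nc_schur_row_comp
    by (rule sum.reindex_bij_witness[where i = "\<lambda>b. n - b" and j = "\<lambda>b. n - b"]) auto
  also have "\<dots> = (\<Sum>b\<le>n. (- 1) ^ b * (H (row_comp (n - b)) * nc_schur (column_comp b)))"
  proof (intro sum.cong refl)
    show "H (row_comp (n - b)) * ((- 1) ^ b * nc_schur (column_comp b)) =
        (- 1) ^ b * (H (row_comp (n - b)) * nc_schur (column_comp b) :: 'a nsym)" for b
      by (cases "even b") simp_all
  qed
  also have "\<dots> = 1 $ n"
    using sum_H_row_mult_LV_nc_schur[of n 0, where 'a = 'a] by (simp add: LV_zero_iff nc_schur_0)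
  finally show "(row_series * column_series) $ n = (1 :: 'a nsym fps) $ n" .
qed

text \<open>Coefficients do not commute, so the product in this order needs its own argument: the
  constant term 1 provides some left inverse, and a left inverse equals any right inverse.\<close>

lemma column_series_mult_row_series: "column_series * row_series = (1 :: 'a::field_char_0 nsym fps)"
proof -
  have "row_series $ 0 = (1 :: 'a nsym)" by (simp add: row_series_def nc_schur_0)
  then have L: "fps_left_inverse row_series 1 * row_series = (1 :: 'a nsym fps)" (is "?L * _ = _")
    by (intro fps_left_inverse) simp
  have "?L = ?L * (row_series * column_series)" by (simp add: row_series_mult_column_series)
  also have "\<dots> = column_series" by (simp only: mult.assoc[symmetric] L mult_1_left)
  finally show ?thesis using L by (simp only:)
qed

section \<open>Row and column series in the tensor square\<close>

context
  fixes HL HR HD EL ER ED :: "'a::field_char_0 nsym2 fps"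
  defines "HL \<equiv> fps_map (\<lambda>g. tensor g 1) row_series" and "HR \<equiv> fps_map (tensor 1) row_series"
    and "HD \<equiv> fps_map coproduct row_series"
    and "EL \<equiv> fps_map (\<lambda>g. tensor g 1) column_series" and "ER \<equiv> fps_map (tensor 1) column_series"
    and "ED \<equiv> fps_map coproduct column_series"
begin

text \<open>The first form is the definition of \<Delta> on generators; the second holds because g
  \<otimes> 1 and 1 \<otimes> h commute. The factor to be cancelled must stand on the left, which is
  \<open>HR\<close> for the row identity and \<open>HL\<close> for the column identity.\<close>

lemma coproduct_row_series: "HD = HL * HR" "HD = HR * HL"
proof -
  have "HD $ n = (\<Sum>i\<le>n. tensor (H (row_comp i)) (H (row_comp (n - i))))" for n
    by (simp add: HD_def row_series_def nc_schur_row_comp coproduct_H_row coproduct_gen_def)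
  then show "HD = HL * HR"
    by (intro fps_ext) (simp add: HL_def HR_def row_series_def nc_schur_row_comp fps_mult_nth tensor_mult atLeast0AtMost)
  also have "HL * HR = HR * HL"
  proof (rule fps_ext)
    show "(HL * HR) $ n = (HR * HL) $ n" for n
      unfolding fps_mult_nth
      by (rule sum.reindex_bij_witness[where i = "\<lambda>i. n - i" and j = "\<lambda>i. n - i"])
        (auto simp: HL_def HR_def tensor_mult)
  qed
  finally show "HD = HR * HL" .
qed

lemma row_series_left_eq: "HL = ER * HD"
proof -
  have "ER * HR = 1"
    unfolding ER_def HR_def by (simp add: fps_map_mult[symmetric] fps_map_1 ring_morphism_tensor_right column_series_mult_row_series)
  then have "HL = ER * HR * HL" by simp
  then show ?thesis by (simp add: coproduct_row_series(2) mult.assoc)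
qed

text \<open>\<Delta> is a ring morphism, so \<open>ED\<close> is inverse to \<open>HD\<close>, and
  \<open>EL * HL * HR * ED\<close> collapses from the left to \<open>HR * ED\<close> and from the
  right to \<open>EL\<close>.\<close>

lemma column_series_left_eq: "EL = HR * ED"
proof -
  have "EL * HL = 1"
    unfolding EL_def HL_def by (simp add: fps_map_mult[symmetric] fps_map_1 ring_morphism_tensor_left column_series_mult_row_series)
  then have "HR * ED = EL * HL * (HR * ED)" by simp
  also have "\<dots> = EL * (HD * ED)" by (simp add: coproduct_row_series(1) mult.assoc)
  also have "HD * ED = 1"
    unfolding HD_def ED_def by (simp add: fps_map_mult[symmetric] fps_map_1 ring_morphism_coproduct row_series_mult_column_series)
  finally show ?thesis by simp
qed

lemma tensor_row_left:
  "tensor (nc_schur (row_comp n)) (1 :: 'a nsym) =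
     (\<Sum>b\<le>n. (- 1) ^ b * (tensor 1 (nc_schur (column_comp b)) * coproduct (nc_schur (row_comp (n - b)))))"
proof -
  have "HL $ n = (\<Sum>b\<le>n. ER $ b * HD $ (n - b))"
    by (subst row_series_left_eq) (simp add: fps_mult_nth atLeast0AtMost)
  then show ?thesis
    by (simp add: HL_def ER_def HD_def row_series_def column_series_def
        ring_morphism_neg_one_power[OF ring_morphism_tensor_right] mult.assoc)
qed

lemma tensor_column_left:
  "tensor (nc_schur (column_comp n)) (1 :: 'a nsym) =
     (\<Sum>b\<le>n. (- 1) ^ b * (tensor 1 (nc_schur (row_comp b)) * coproduct (nc_schur (column_comp (n - b)))))"
proof -
  have "EL $ n = (\<Sum>b\<le>n. HR $ b * ED $ (n - b))"
    by (subst column_series_left_eq) (simp add: fps_mult_nth atLeast0AtMost)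
  then have "(- 1) ^ n * tensor (nc_schur (column_comp n)) (1 :: 'a nsym) = (\<Sum>b\<le>n. tensor 1 (nc_schur (row_comp b)) *
      ((- 1) ^ (n - b) * coproduct (nc_schur (column_comp (n - b)))))"
    by (simp add: EL_def HR_def ED_def row_series_def column_series_def
        ring_morphism_neg_one_power[OF ring_morphism_tensor_left] ring_morphism_neg_one_power[OF ring_morphism_coproduct])
  \<comment> \<open>The columns carry signs on both sides; as n + (n - b) has the parity of b, a
    further factor (-1)^n leaves (-1)^b on the right and none on the left.\<close>
  then have "(- 1) ^ n * ((- 1) ^ n * tensor (nc_schur (column_comp n)) (1 :: 'a nsym)) =
      (\<Sum>b\<le>n. (- 1) ^ n * (tensor 1 (nc_schur (row_comp b)) *
        ((- 1) ^ (n - b) * coproduct (nc_schur (column_comp (n - b))))))"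
    by (simp add: sum_distrib_left)
  also have "\<dots> = (\<Sum>b\<le>n. (- 1) ^ b * (tensor 1 (nc_schur (row_comp b)) * coproduct (nc_schur (column_comp (n - b)))))"
  proof (intro sum.cong refl)
    fix b assume "b \<in> {..n}"
    then obtain m where n: "n = b + m" using le_Suc_ex by auto
    show "(- 1) ^ n * (tensor 1 (nc_schur (row_comp b)) * ((- 1) ^ (n - b) * coproduct (nc_schur (column_comp (n - b))))) =
        (- 1) ^ b * (tensor 1 (nc_schur (row_comp b)) * coproduct (nc_schur (column_comp (n - b)) :: 'a nsym))"
      by (cases "even b"; cases "even m") (simp_all add: n)
  qed
  finally show ?thesis by (simp add: mult.assoc[symmetric] power_add[symmetric] mult_2[symmetric])
qed

end

text \<open>It suffices to test h on the basis of noncommutative Schur functions, where both sides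
  are indicators of P. For columns this is the only access to the adjoint, since their Pieri rule
  does not come from counting fillings.\<close>

lemma pairing_nc_schur_mult:
  fixes h :: "'a::field_char_0 nsym"
  assumes "\<And>\<alpha>. e * nc_schur \<alpha> = (\<Sum>\<rho> | P \<alpha> \<rho>. nc_schur \<rho>)" "\<And>\<alpha>. finite {\<rho>. P \<alpha> \<rho>}" "finite {\<mu>. P \<mu> \<eta>}"
  shows "pairing (e * h) (qsym_schur \<eta>) = (\<Sum>\<mu> | P \<mu> \<eta>. pairing h (qsym_schur \<mu>))"
proof (induction h rule: nc_schur_induct)
  case (single c \<beta>)
  have "e * (Poly_Mapping.single 0 c * nc_schur \<beta>) = Poly_Mapping.single 0 c * (\<Sum>\<rho> | P \<beta> \<rho>. nc_schur \<rho>)"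
    by (simp add: assms(1)[symmetric] mult.assoc[symmetric] single_0_commute)
  then show ?case
    using assms(2)[of \<beta>] assms(3) by (simp add: pairing_scale pairing_sum pairing_nc_schur mult_delta_right)
qed (simp_all add: distrib_left pairing_add sum.distrib)

text \<open>Stated for an abstract pair of families a and b, so that both identities are instances
  with rows and columns exchanged: P describes the growth of the outer shape under a, Q the removal
  from the inner shape caused by b.\<close>

lemma mult_skew_nc_schur:
  fixes a b :: "nat \<Rightarrow> 'a::field_char_0 nsym"
  assumes coprod: "tensor (a n) 1 = (\<Sum>i\<le>n. (- 1) ^ i * (tensor 1 (b i) * coproduct (a (n - i))))"
    and a: "\<And>m \<alpha>. a m * nc_schur \<alpha> = (\<Sum>\<rho> | P m \<alpha> \<rho>. nc_schur \<rho>)"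
    and b: "\<And>m \<alpha>. b m * nc_schur \<alpha> = (\<Sum>\<rho> | Q m \<alpha> \<rho>. nc_schur \<rho>)"
    and fin: "\<And>m \<alpha>. finite {\<rho>. P m \<alpha> \<rho>}" "\<And>m \<alpha>. finite {\<rho>. Q m \<alpha> \<rho>}" "\<And>m \<eta>. finite {\<mu>. Q m \<mu> \<eta>}"
  shows "a n * skew_nc_schur \<Lambda> \<eta> = (\<Sum>(i, j) | i + j = n. (- 1) ^ j *
    (\<Sum>(\<rho>, \<mu>) | P i \<Lambda> \<rho> \<and> Q j \<mu> \<eta>. skew_nc_schur \<rho> \<mu>))"
proof -
  let ?D = "\<lambda>\<alpha>. coproduct (nc_schur \<alpha>) :: 'a nsym2"
  have term_eq: "right_pairing (tensor 1 (b j) * (coproduct (a i) * ?D \<Lambda>)) (qsym_schur \<eta>) =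
      (\<Sum>(\<rho>, \<mu>) | P i \<Lambda> \<rho> \<and> Q j \<mu> \<eta>. skew_nc_schur \<rho> \<mu>)" for i j
  proof -
    have "coproduct (a i) * ?D \<Lambda> = (\<Sum>\<rho> | P i \<Lambda> \<rho>. ?D \<rho>)"
      unfolding coproduct_mult[symmetric] a by (rule ring_morphism_sum[OF ring_morphism_coproduct])
    moreover have "right_pairing (tensor 1 (b j) * X) (qsym_schur \<eta>) = (\<Sum>\<mu> | Q j \<mu> \<eta>. right_pairing X (qsym_schur \<mu>))" for X
      by (intro right_pairing_mult_right pairing_nc_schur_mult b fin)
    ultimately have "right_pairing (tensor 1 (b j) * (coproduct (a i) * ?D \<Lambda>)) (qsym_schur \<eta>) =
        (\<Sum>\<mu> | Q j \<mu> \<eta>. \<Sum>\<rho> | P i \<Lambda> \<rho>. skew_nc_schur \<rho> \<mu>)"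
      by (simp add: right_pairing_sum skew_nc_schur_eq)
    also have "\<dots> = (\<Sum>\<rho> | P i \<Lambda> \<rho>. \<Sum>\<mu> | Q j \<mu> \<eta>. skew_nc_schur \<rho> \<mu>)"
      by (rule sum.swap)
    also have "\<dots> = (\<Sum>(\<rho>, \<mu>)\<in>{\<rho>. P i \<Lambda> \<rho>} \<times> {\<mu>. Q j \<mu> \<eta>}. skew_nc_schur \<rho> \<mu>)"
      by (rule sum.cartesian_product)
    also have "{\<rho>. P i \<Lambda> \<rho>} \<times> {\<mu>. Q j \<mu> \<eta>} = {(\<rho>, \<mu>). P i \<Lambda> \<rho> \<and> Q j \<mu> \<eta>}" by auto
    finally show ?thesis .
  qed
  have "a n * skew_nc_schur \<Lambda> \<eta> = right_pairing (tensor (a n) 1 * ?D \<Lambda>) (qsym_schur \<eta>)"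
    by (simp add: right_pairing_mult_left skew_nc_schur_eq)
  also have "\<dots> = (\<Sum>j\<le>n. (- 1) ^ j * right_pairing (tensor 1 (b j) * (coproduct (a (n - j)) * ?D \<Lambda>)) (qsym_schur \<eta>))"
    by (simp add: coprod sum_distrib_right right_pairing_sum mult.assoc right_pairing_neg_one_power)
  also have "\<dots> = (\<Sum>(i, j) | i + j = n. (- 1) ^ j *
      right_pairing (tensor 1 (b j) * (coproduct (a i) * ?D \<Lambda>)) (qsym_schur \<eta>))"
    by (rule sum.reindex_bij_witness[where i = snd and j = "\<lambda>j. (n - j, j)"]) auto
  finally show ?thesis unfolding term_eq .
qed

theorem corollary5p3:
  fixes n :: nat and \<Lambda> \<eta> :: composition
  assumes "n \<ge> 1"
  shows "(nc_schur (row_comp n) :: 'a::field_char_0 nsym) * skew_nc_schur \<Lambda> \<eta> =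
      (\<Sum>(a, b) | a + b = n. (- 1) ^ b *
        (\<Sum>(\<rho>, \<mu>) | LH a \<Lambda> \<rho> \<and> LV b \<mu> \<eta>. skew_nc_schur \<rho> \<mu>)) \<and>
    (nc_schur (column_comp n) :: 'a nsym) * skew_nc_schur \<Lambda> \<eta> =
      (\<Sum>(a, b) | a + b = n. (- 1) ^ b *
        (\<Sum>(\<rho>, \<mu>) | LV a \<Lambda> \<rho> \<and> LH b \<mu> \<eta>. skew_nc_schur \<rho> \<mu>))"
proof
  have row: "nc_schur (row_comp m) * nc_schur \<alpha> = (\<Sum>\<rho> | LH m \<alpha> \<rho>. nc_schur \<rho> :: 'a nsym)" for m \<alpha>
    by (simp add: nc_schur_row_comp H_row_mult_nc_schur)
  show "(nc_schur (row_comp n) :: 'a nsym) * skew_nc_schur \<Lambda> \<eta> =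
      (\<Sum>(a, b) | a + b = n. (- 1) ^ b * (\<Sum>(\<rho>, \<mu>) | LH a \<Lambda> \<rho> \<and> LV b \<mu> \<eta>. skew_nc_schur \<rho> \<mu>))"
    by (rule mult_skew_nc_schur[where a = "\<lambda>n. nc_schur (row_comp n)" and b = "\<lambda>n. nc_schur (column_comp n)",
          OF tensor_row_left row nc_schur_column_mult_nc_schur]) simp_all
  show "(nc_schur (column_comp n) :: 'a nsym) * skew_nc_schur \<Lambda> \<eta> =
      (\<Sum>(a, b) | a + b = n. (- 1) ^ b * (\<Sum>(\<rho>, \<mu>) | LV a \<Lambda> \<rho> \<and> LH b \<mu> \<eta>. skew_nc_schur \<rho> \<mu>))"
    by (rule mult_skew_nc_schur[where a = "\<lambda>n. nc_schur (column_comp n)" and b = "\<lambda>n. nc_schur (row_comp n)",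
          OF tensor_column_left nc_schur_column_mult_nc_schur row]) simp_all
qed

end
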